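(* Let $\mathcal{R}$ be a finite-dimensional quasiassociative algebra over $\mathbf{R}$, $\mathcal{G}=Lie(\mathcal{R})$, and $G$ a connected Lie group with the Lie algebra $\mathcal{G}$. Then the Lie algebra $\mathcal{D}(G)$ of (smooth) vector fields on $G$ has a quasiassociative representation, i.e. there is an $\mathbf{R}$-bilinear quasiassociative multiplication $*$ on $\mathcal{D}(G)$ such that $X*Y-Y*X=[X,Y]$ for all $X,Y\in\mathcal{D}(G)$.
   Context: An algebra with bilinear multiplication $*$ is quasiassociative if $a*(b*c)-(a*b)*c=b*(a*c)-(b*a)*c$ for all elements $a,b,c$. For a quasiassociative algebra $\mathcal{R}$, $Lie(\mathcal{R})$ denotes the Lie algebra on the same vector space with bracket $[a,b]=a*b-b*a$. $[X,Y]$ is the usual commutator of vector fields. *)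

theory Defs
  imports "HOL-Analysis.Analysis"
begin

section \<open>Quasiassociative algebras\<close>

text \<open>
  The carrier and the subtraction are parameters because the notion is used both for an algebra on
  a real vector space type and for the vector fields, which form a proper subset of a function type
  without a vector space instance.
\<close>

definition quasiassociative_on :: "'v set \<Rightarrow> ('v \<Rightarrow> 'v \<Rightarrow> 'v) \<Rightarrow> ('v \<Rightarrow> 'v \<Rightarrow> 'v) \<Rightarrow> bool" where
  "quasiassociative_on S diff prd \<longleftrightarrow>
     (\<forall>a\<in>S. \<forall>b\<in>S. \<forall>c\<in>S.
        diff (prd a (prd b c)) (prd (prd a b) c) =
        diff (prd b (prd a c)) (prd (prd b a) c))"

definition commutator_bracket :: "('r::real_vector \<Rightarrow> 'r \<Rightarrow> 'r) \<Rightarrow> 'r \<Rightarrow> 'r \<Rightarrow> 'r" where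
  "commutator_bracket prd a b = prd a b - prd b a"


section \<open>Smooth functions on open subsets of n-space\<close>

text \<open>
  Points of n-space are the functions \<^typ>\<open>nat \<Rightarrow> real\<close> that vanish from index \<open>n\<close> on, with the
  library topology \<^const>\<open>Euclidean_space\<close>; in this way the dimension is a natural number,
  zero included. The set \<open>S\<close> below is always open in \<open>Euclidean_space n\<close>, so that a partial
  derivative at a point of \<open>S\<close> depends only on the values of the function on \<open>S\<close>.
\<close>

definition partial_derivative :: "nat \<Rightarrow> ((nat \<Rightarrow> real) \<Rightarrow> real) \<Rightarrow> (nat \<Rightarrow> real) \<Rightarrow> real" where
  "partial_derivative i f x = deriv (\<lambda>t. f (x(i := t))) (x i)"

primrec Ck_on :: "nat \<Rightarrow> nat \<Rightarrow> (nat \<Rightarrow> real) set \<Rightarrow> ((nat \<Rightarrow> real) \<Rightarrow> real) \<Rightarrow> bool" where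
  "Ck_on n 0 S f \<longleftrightarrow> continuous_map (subtopology (Euclidean_space n) S) euclideanreal f"
| "Ck_on n (Suc k) S f \<longleftrightarrow>
     continuous_map (subtopology (Euclidean_space n) S) euclideanreal f \<and>
     (\<forall>i<n. (\<forall>x\<in>S. (\<lambda>t. f (x(i := t))) differentiable (at (x i))) \<and>
             Ck_on n k S (partial_derivative i f))"

definition smooth_fun_on :: "nat \<Rightarrow> (nat \<Rightarrow> real) set \<Rightarrow> ((nat \<Rightarrow> real) \<Rightarrow> real) \<Rightarrow> bool" where
  "smooth_fun_on n S f \<longleftrightarrow> (\<forall>k. Ck_on n k S f)"

definition smooth_map_on ::
    "nat \<Rightarrow> nat \<Rightarrow> (nat \<Rightarrow> real) set \<Rightarrow> ((nat \<Rightarrow> real) \<Rightarrow> (nat \<Rightarrow> real)) \<Rightarrow> bool" where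
  "smooth_map_on n m S F \<longleftrightarrow> (\<forall>j<m. smooth_fun_on n S (\<lambda>x. F x j))"


section \<open>Smooth manifolds\<close>

text \<open>
  A chart is an open domain together with its coordinate map; only the values of the coordinate map
  on the domain matter. The underlying set of a manifold is a whole type, whose topology is the one
  of the type class. An atlas need not be maximal: it determines the smooth structure.
\<close>

type_synonym 'a chart = "'a set \<times> ('a \<Rightarrow> nat \<Rightarrow> real)"

definition is_chart :: "nat \<Rightarrow> ('a::topological_space) chart \<Rightarrow> bool" where
  "is_chart n = (\<lambda>(U, \<phi>).
     open U \<and> openin (Euclidean_space n) (\<phi> ` U) \<and>
     homeomorphic_map (top_of_set U) (subtopology (Euclidean_space n) (\<phi> ` U)) \<phi>)"

definition smooth_transition :: "nat \<Rightarrow> 'a chart \<Rightarrow> 'a chart \<Rightarrow> bool" where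
  "smooth_transition n = (\<lambda>(U, \<phi>) (V, \<psi>).
     smooth_map_on n n (\<phi> ` (U \<inter> V)) (\<psi> \<circ> inv_into U \<phi>))"

definition smooth_manifold ::
    "nat \<Rightarrow> ('a::{t2_space, second_countable_topology}) chart set \<Rightarrow> bool" where
  "smooth_manifold n A \<longleftrightarrow>
     (\<forall>c\<in>A. is_chart n c) \<and> (\<Union>c\<in>A. fst c) = UNIV \<and>
     (\<forall>c\<in>A. \<forall>d\<in>A. smooth_transition n c d)"

definition smooth_map ::
    "nat \<Rightarrow> ('a::topological_space) chart set \<Rightarrow> nat \<Rightarrow> ('b::topological_space) chart set
      \<Rightarrow> ('a \<Rightarrow> 'b) \<Rightarrow> bool" where
  "smooth_map n A m B F \<longleftrightarrow>
     continuous_on UNIV F \<and>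
     (\<forall>(U, \<phi>)\<in>A. \<forall>(V, \<psi>)\<in>B.
        smooth_map_on n m (\<phi> ` (U \<inter> F -` V)) (\<psi> \<circ> F \<circ> inv_into U \<phi>))"

definition smooth_functions :: "nat \<Rightarrow> 'a chart set \<Rightarrow> ('a \<Rightarrow> real) set" where
  "smooth_functions n A = {f. \<forall>(U, \<phi>)\<in>A. smooth_fun_on n (\<phi> ` U) (f \<circ> inv_into U \<phi>)}"

text \<open>Products of charts; the coordinates of the second factor follow those of the first.\<close>

definition product_chart :: "nat \<Rightarrow> 'a chart \<Rightarrow> 'b chart \<Rightarrow> ('a \<times> 'b) chart" where
  "product_chart n = (\<lambda>(U, \<phi>) (V, \<psi>).
     (U \<times> V, \<lambda>(p, q) i. if i < n then \<phi> p i else \<psi> q (i - n)))"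

definition product_atlas :: "nat \<Rightarrow> 'a chart set \<Rightarrow> 'b chart set \<Rightarrow> ('a \<times> 'b) chart set" where
  "product_atlas n A B = {product_chart n c d | c d. c \<in> A \<and> d \<in> B}"


section \<open>Tangent vectors and vector fields\<close>

text \<open>
  A tangent vector at \<open>p\<close> is a derivation at \<open>p\<close> of the algebra of smooth functions. As functions are
  total here, a tangent vector is a function on all \<^typ>\<open>'a \<Rightarrow> real\<close>; it is required to vanish on the
  functions that are not smooth, so that equality of tangent vectors and of vector fields means
  equality on smooth functions.
\<close>

definition tangent_space :: "nat \<Rightarrow> 'a chart set \<Rightarrow> 'a \<Rightarrow> (('a \<Rightarrow> real) \<Rightarrow> real) set" where
  "tangent_space n A p = {v.
     (\<forall>f. f \<notin> smooth_functions n A \<longrightarrow> v f = 0) \<and>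
     (\<forall>f\<in>smooth_functions n A. \<forall>g\<in>smooth_functions n A. v (\<lambda>q. f q + g q) = v f + v g) \<and>
     (\<forall>c. \<forall>f\<in>smooth_functions n A. v (\<lambda>q. c * f q) = c * v f) \<and>
     (\<forall>f\<in>smooth_functions n A. \<forall>g\<in>smooth_functions n A.
        v (\<lambda>q. f q * g q) = v f * g p + f p * v g)}"

text \<open>The differential of a smooth map into a manifold \<open>(m, B)\<close>, applied to one tangent vector.\<close>

definition pushforward ::
    "nat \<Rightarrow> 'b chart set \<Rightarrow> ('a \<Rightarrow> 'b) \<Rightarrow> (('a \<Rightarrow> real) \<Rightarrow> real) \<Rightarrow> (('b \<Rightarrow> real) \<Rightarrow> real)" where
  "pushforward m B F v = (\<lambda>f. if f \<in> smooth_functions m B then v (f \<circ> F) else 0)"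

type_synonym 'a vfield = "'a \<Rightarrow> ('a \<Rightarrow> real) \<Rightarrow> real"

definition vector_fields :: "nat \<Rightarrow> 'a chart set \<Rightarrow> 'a vfield set" where
  "vector_fields n A = {X.
     (\<forall>p. X p \<in> tangent_space n A p) \<and>
     (\<forall>f\<in>smooth_functions n A. (\<lambda>p. X p f) \<in> smooth_functions n A)}"

definition vf_add :: "'a vfield \<Rightarrow> 'a vfield \<Rightarrow> 'a vfield" where
  "vf_add X Y = (\<lambda>p f. X p f + Y p f)"

definition vf_diff :: "'a vfield \<Rightarrow> 'a vfield \<Rightarrow> 'a vfield" where
  "vf_diff X Y = (\<lambda>p f. X p f - Y p f)"

definition vf_scale :: "real \<Rightarrow> 'a vfield \<Rightarrow> 'a vfield" where
  "vf_scale c X = (\<lambda>p f. c * X p f)"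

definition vf_bracket :: "'a vfield \<Rightarrow> 'a vfield \<Rightarrow> 'a vfield" where
  "vf_bracket X Y = (\<lambda>p f. X p (\<lambda>q. Y q f) - Y p (\<lambda>q. X q f))"

definition vf_bilinear_on :: "'a vfield set \<Rightarrow> ('a vfield \<Rightarrow> 'a vfield \<Rightarrow> 'a vfield) \<Rightarrow> bool" where
  "vf_bilinear_on D prd \<longleftrightarrow>
     (\<forall>X\<in>D. \<forall>Y\<in>D. \<forall>Z\<in>D.
        prd (vf_add X Y) Z = vf_add (prd X Z) (prd Y Z) \<and>
        prd Z (vf_add X Y) = vf_add (prd Z X) (prd Z Y)) \<and>
     (\<forall>c. \<forall>X\<in>D. \<forall>Y\<in>D.
        prd (vf_scale c X) Y = vf_scale c (prd X Y) \<and>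
        prd X (vf_scale c Y) = vf_scale c (prd X Y))"


section \<open>Lie groups and their Lie algebras\<close>

definition lie_group ::
    "nat \<Rightarrow> ('g::{t2_space, second_countable_topology}) chart set
      \<Rightarrow> ('g \<Rightarrow> 'g \<Rightarrow> 'g) \<Rightarrow> 'g \<Rightarrow> ('g \<Rightarrow> 'g) \<Rightarrow> bool" where
  "lie_group n A gmult e ginv \<longleftrightarrow>
     group gmult e ginv \<and> smooth_manifold n A \<and>
     smooth_map (n + n) (product_atlas n A A) n A (\<lambda>(p, q). gmult p q) \<and>
     smooth_map n A n A ginv"

definition left_invariant_vector_fields ::
    "nat \<Rightarrow> 'g chart set \<Rightarrow> ('g \<Rightarrow> 'g \<Rightarrow> 'g) \<Rightarrow> 'g vfield set" where
  "left_invariant_vector_fields n A gmult =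
     {X \<in> vector_fields n A. \<forall>p q. pushforward n A (gmult p) (X q) = X (gmult p q)}"

text \<open>
  That \<open>bracket\<close> on the vector space \<^typ>\<open>'r\<close> is the Lie algebra of the group: it is isomorphic,
  as a Lie algebra, to the left-invariant vector fields.
\<close>

definition has_lie_algebra ::
    "nat \<Rightarrow> 'g chart set \<Rightarrow> ('g \<Rightarrow> 'g \<Rightarrow> 'g) \<Rightarrow> ('r::real_vector \<Rightarrow> 'r \<Rightarrow> 'r) \<Rightarrow> bool" where
  "has_lie_algebra n A gmult bracket \<longleftrightarrow>
     (\<exists>\<Phi>. bij_betw \<Phi> UNIV (left_invariant_vector_fields n A gmult) \<and>
        (\<forall>a b. \<Phi> (a + b) = vf_add (\<Phi> a) (\<Phi> b)) \<and>
        (\<forall>c a. \<Phi> (c *\<^sub>R a) = vf_scale c (\<Phi> a)) \<and>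
        (\<forall>a b. \<Phi> (bracket a b) = vf_bracket (\<Phi> a) (\<Phi> b)))"

end

theory Submission
  imports Defs
begin

text \<open>
  The left-invariant vector fields \<open>\<Phi> a\<close> (\<open>a\<close> in the algebra) form a global frame of the tangent
  bundle, so every vector field is \<open>X p = \<Phi> (\<alpha> X p) p\<close> for a unique smooth algebra-valued function
  \<open>\<alpha> X\<close>. The product \<open>X * Y\<close> is the field with \<open>\<alpha> (X * Y) = X (\<alpha> Y) + \<alpha> X \<cdot> \<alpha> Y\<close>: the covariant
  derivative of the left-invariant connection given by the algebra, which is torsion-free because
  the commutator of the algebra is the Lie bracket, and flat because of quasiassociativity.
  That the frame spans, with smooth coefficients, rests on Hadamard's lemma, by which a derivation
  is a combination of coordinate derivatives.
\<close>

section \<open>Differential calculus in coordinates\<close>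

text \<open>Tangent vectors accept only globally defined smooth functions, while Hadamard's formula
  lives in a chart. Bump functions bridge the gap: they turn coordinates and Hadamard coefficients
  into global smooth functions to which a derivation applies. Since \<open>Ck_on\<close> is defined
  by iterated partial derivatives, arguments move along coordinate lines; this is why boxes take the
  place of balls.

  The frame fields are only shown to span. Uniqueness of \<open>\<alpha> X p\<close> comes from
  another source: a left-invariant field is determined by its value at one point, so
  \<open>\<Phi> a p\<close> determines \<open>a\<close>. The algebra is a bare real vector space, so
  smoothness of algebra-valued functions is read off coordinates in a fixed finite basis.

  Why flatness is the right condition: writing D_X Z for X * Z, the difference of the two sides of
  quasiassociativity is D_X D_Y Z - D_Y D_X Z - D_W Z with W = X * Y - Y * X. Once torsion vanishes,
  W is the bracket of X and Y, and this expression is the curvature applied to Z.\<close>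

lemma Euclidean_space_eq_top_of_set:
  "Euclidean_space n = top_of_set (topspace (Euclidean_space n))"
  unfolding topspace_Euclidean_space
  by (simp add: Euclidean_space_def euclidean_product_topology)

lemma continuous_map_Euclidean_subtopology:
  assumes "S \<subseteq> topspace (Euclidean_space n)"
  shows "continuous_map (subtopology (Euclidean_space n) S) euclidean f \<longleftrightarrow> continuous_on S f"
proof -
  have "subtopology (Euclidean_space n) S = top_of_set S"
    using assms by (metis Euclidean_space_eq_top_of_set inf.absorb_iff2 subtopology_subtopology)
  then show ?thesis
    by (simp add: continuous_map_iff_continuous)
qed

lemma fun_upd_in_Euclidean_space:
  "x \<in> topspace (Euclidean_space n) \<Longrightarrow> i < n \<Longrightarrow> x(i := t) \<in> topspace (Euclidean_space n)"
  by (auto simp: topspace_Euclidean_space)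

lemma continuous_on_fun_upd: "continuous_on T (\<lambda>t. (x::nat \<Rightarrow> real)(i := t))"
proof (rule continuous_on_coordinatewise_then_product)
  show "continuous_on T (\<lambda>t. (x(i := t)) j)" for j
    by (cases "j = i") auto
qed

lemma open_Collect_fun_upd:
  assumes S: "openin (Euclidean_space n) S" and "x \<in> topspace (Euclidean_space n)" "i < n"
  shows "open {t. x(i := t) \<in> S}"
proof -
  obtain W where W: "open W" "S = topspace (Euclidean_space n) \<inter> W"
    using S by (metis Euclidean_space_eq_top_of_set openin_open)
  have "{t. x(i := t) \<in> S} = (\<lambda>t. x(i := t)) -` W"
    using W fun_upd_in_Euclidean_space[OF assms(2,3)] by auto
  then show ?thesis
    using W(1) continuous_on_fun_upd[of UNIV x i] by (simp add: open_vimage)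
qed

text \<open>This is how openness makes partial derivatives local: a short piece of each coordinate
  line through a point of \<open>S\<close> stays in \<open>S\<close>.\<close>

lemma eventually_fun_upd:
  assumes S: "openin (Euclidean_space n) S" and "x \<in> S" "i < n"
  shows "\<forall>\<^sub>F t in nhds (x i). x(i := t) \<in> S"
proof -
  have "x \<in> topspace (Euclidean_space n)"
    using assms openin_subset by blast
  with open_Collect_fun_upd[OF S this \<open>i < n\<close>] \<open>x \<in> S\<close> show ?thesis
    by (auto simp: eventually_nhds intro!: exI[of _ "{t. x(i := t) \<in> S}"])
qed

lemma Ck_on_continuous:
  assumes "S \<subseteq> topspace (Euclidean_space n)" "Ck_on n k S f"
  shows "continuous_on S f"
  using assms by (cases k) (auto simp: continuous_map_Euclidean_subtopology)

lemma Ck_on_SucD: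
  assumes "Ck_on n (Suc k) S f" "i < n"
  shows "Ck_on n k S (partial_derivative i f)"
    and "x \<in> S \<Longrightarrow> ((\<lambda>t. f (x(i := t))) has_field_derivative partial_derivative i f x) (at (x i))"
  using assms
  by (auto simp: partial_derivative_def DERIV_deriv_iff_real_differentiable)

lemma Ck_on_SucD_at:
  assumes "Ck_on n (Suc k) S f" "i < n" "x(i := t) \<in> S"
  shows "((\<lambda>t. f (x(i := t))) has_field_derivative partial_derivative i f (x(i := t))) (at t)"
  using Ck_on_SucD(2)[OF assms] by simp

lemma partial_derivative_eqI:
  "((\<lambda>t. f (x(i := t))) has_field_derivative d) (at (x i)) \<Longrightarrow> partial_derivative i f x = d"
  unfolding partial_derivative_def by (rule DERIV_imp_deriv)

lemma partial_derivative_cong: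
  assumes S: "openin (Euclidean_space n) S" and "x \<in> S" "i < n" and "\<And>x. x \<in> S \<Longrightarrow> f x = g x"
  shows "partial_derivative i f x = partial_derivative i g x"
  unfolding partial_derivative_def
  by (rule deriv_cong_ev) (use eventually_fun_upd[OF assms(1-3)] assms(4) in \<open>auto elim: eventually_mono\<close>)

text \<open>Functions in charts have the form \<open>f \<circ> inv_into U \<phi>\<close>, whose
  values off the chart image are arbitrary. As \<open>S\<close> is open, neither continuity on
  \<open>S\<close> nor any partial derivative at a point of \<open>S\<close> sees those
  values.\<close>

lemma Ck_on_cong_imp:
  assumes S: "openin (Euclidean_space n) S"
  shows "(\<And>x. x \<in> S \<Longrightarrow> f x = g x) \<Longrightarrow> Ck_on n k S f \<Longrightarrow> Ck_on n k S g"
proof (induction k arbitrary: f g)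
  case 0
  then show ?case
    using openin_subset[OF S] by (simp add: continuous_map_Euclidean_subtopology cong: continuous_on_cong)
next
  case (Suc k)
  have cont: "continuous_on S g"
    using Ck_on_continuous[OF openin_subset[OF S] Suc.prems(2)] Suc.prems(1)
    by (simp cong: continuous_on_cong)
  have "(\<lambda>t. g (x(i := t))) differentiable at (x i)" if "x \<in> S" "i < n" for x i
  proof -
    have "((\<lambda>t. f (x(i := t))) has_field_derivative partial_derivative i f x) (at (x i))"
      using Ck_on_SucD(2)[OF Suc.prems(2)] that by blast
    then have "((\<lambda>t. g (x(i := t))) has_field_derivative partial_derivative i f x) (at (x i))"
      by (rule has_field_derivative_cong_ev[THEN iffD1, rotated -1])
        (use eventually_fun_upd[OF S that] Suc.prems(1) that in \<open>auto elim!: eventually_mono\<close>)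
    then show ?thesis
      using real_differentiable_def by blast
  qed
  moreover have "Ck_on n k S (partial_derivative i g)" if "i < n" for i
    by (rule Suc.IH[of "partial_derivative i f"])
      (use partial_derivative_cong[OF S _ that Suc.prems(1)] Ck_on_SucD(1)[OF Suc.prems(2) that] in auto)
  ultimately show ?case
    using cont openin_subset[OF S] by (simp add: continuous_map_Euclidean_subtopology)
qed

text \<open>Accepts explicit formulas \<open>g i\<close> for the partial derivatives, so that
  inductions on \<open>k\<close> can work with sum, product and chain rule expressions instead of
  \<open>partial_derivative i f\<close>.\<close>

lemma Ck_on_SucI:
  assumes S: "openin (Euclidean_space n) S" and "continuous_on S f"
    and der: "\<And>i x. i < n \<Longrightarrow> x \<in> S \<Longrightarrow> ((\<lambda>t. f (x(i := t))) has_field_derivative g i x) (at (x i))"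
    and g: "\<And>i. i < n \<Longrightarrow> Ck_on n k S (g i)"
  shows "Ck_on n (Suc k) S f"
proof -
  have "Ck_on n k S (partial_derivative i f)" if "i < n" for i
    by (rule Ck_on_cong_imp[OF S _ g[OF that]]) (use partial_derivative_eqI der that in metis)
  then show ?thesis
    using assms(2) der
    unfolding Ck_on.simps continuous_map_Euclidean_subtopology[OF openin_subset[OF S]] real_differentiable_def
    by blast
qed

lemma Ck_on_Suc_imp: "Ck_on n (Suc k) S f \<Longrightarrow> Ck_on n k S f"
  by (induction k arbitrary: f) auto

lemma Ck_on_subset:
  "Ck_on n k S f \<Longrightarrow> T \<subseteq> S \<Longrightarrow> Ck_on n k T f"
proof (induction k arbitrary: f)
  case 0
  then show ?case
    by (simp add: continuous_map_from_subtopology_mono)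
next
  case (Suc k)
  then show ?case
    by (auto intro: continuous_map_from_subtopology_mono)
qed

text \<open>Continuity and one-variable differentiability are both checked point by point, and the
  induction hypothesis treats the partial derivatives. The lemma serves to glue local coordinate
  expressions.\<close>

lemma Ck_on_local:
  assumes S: "openin (Euclidean_space n) S"
  shows "(\<And>x. x \<in> S \<Longrightarrow> \<exists>T. openin (Euclidean_space n) T \<and> x \<in> T \<and> T \<subseteq> S \<and> Ck_on n k T f) \<Longrightarrow> Ck_on n k S f"
proof (induction k arbitrary: f)
  have cont: "continuous_on S f"
    if *: "\<And>x. x \<in> S \<Longrightarrow> \<exists>T. openin (Euclidean_space n) T \<and> x \<in> T \<and> T \<subseteq> S \<and> Ck_on n k T f"
    for k f
  proof -
    have "continuous (at x within S) f" if x: "x \<in> S" for x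
    proof -
      obtain T where T: "openin (Euclidean_space n) T" "x \<in> T" "T \<subseteq> S" "Ck_on n k T f"
        using *[OF x] by metis
      have "openin (top_of_set (topspace (Euclidean_space n))) T"
        using T(1) by (simp flip: Euclidean_space_eq_top_of_set)
      then obtain W where W: "open W" "T = topspace (Euclidean_space n) \<inter> W"
        unfolding openin_open by metis
      \<comment> \<open>\<open>T\<close> is the trace of the open set \<open>W\<close> on n-space,
        so inside \<open>W\<close> the sets \<open>S\<close> and \<open>T\<close> coincide.\<close>
      have "at x within S = at x within T"
        by (rule at_within_nhd[of x W]) (use W T openin_subset[OF S] in auto)
      then show ?thesis
        using Ck_on_continuous[OF openin_subset[OF T(1)] T(4)] T(2)
        by (simp add: continuous_on_eq_continuous_within)
    qed
    then show ?thesis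
      by (simp add: continuous_on_eq_continuous_within)
  qed
  {
    case 0
    from cont[OF this] show ?case
      using openin_subset[OF S] by (simp add: continuous_map_Euclidean_subtopology)
  next
    case (Suc k)
    have "Ck_on n k S (partial_derivative i f)" if "i < n" for i
      by (rule Suc.IH) (meson Ck_on_SucD(1) Suc.prems that)
    moreover have "(\<lambda>t. f (x(i := t))) differentiable at (x i)" if "x \<in> S" "i < n" for x i
      using Suc.prems[OF that(1)] that(2) by auto
    ultimately show ?case
      using cont[OF Suc.prems] openin_subset[OF S] by (simp add: continuous_map_Euclidean_subtopology)
  }
qed

lemma Ck_on_const:
  assumes S: "openin (Euclidean_space n) S"
  shows "Ck_on n k S (\<lambda>x. c)"
proof (induction k arbitrary: c)
  case 0
  show ?case by simp
next
  case (Suc k)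
  show ?case
    by (rule Ck_on_SucI[OF S, where g = "\<lambda>_ _. 0"]) (auto intro: Suc)
qed

lemma continuous_on_coord: "continuous_on S (\<lambda>x::nat \<Rightarrow> real. x j)"
  by (rule continuous_on_subset[OF continuous_on_product_coordinates]) simp

lemma Ck_on_coord:
  assumes S: "openin (Euclidean_space n) S"
  shows "Ck_on n k S (\<lambda>x. x j)"
proof (cases k)
  case 0
  then show ?thesis
    using openin_subset[OF S] by (simp add: continuous_map_Euclidean_subtopology continuous_on_coord)
next
  case (Suc k')
  have "Ck_on n (Suc k') S (\<lambda>x. x j)"
  proof (rule Ck_on_SucI[OF S, where g = "\<lambda>i _. if i = j then 1 else 0"])
    show "((\<lambda>t. (x(i := t)) j) has_field_derivative (if i = j then 1 else 0)) (at (x i))" for i and x :: "nat \<Rightarrow> real"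
      by (cases "i = j") auto
  qed (rule continuous_on_coord Ck_on_const[OF S])+
  then show ?thesis using Suc by simp
qed

lemma Ck_on_add:
  assumes S: "openin (Euclidean_space n) S"
  shows "Ck_on n k S f \<Longrightarrow> Ck_on n k S g \<Longrightarrow> Ck_on n k S (\<lambda>x. f x + g x)"
proof (induction k arbitrary: f g)
  case 0
  then show ?case
    by (auto intro: continuous_intros)
next
  case (Suc k)
  show ?case
  proof (rule Ck_on_SucI[OF S, where g = "\<lambda>i x. partial_derivative i f x + partial_derivative i g x"])
    show "continuous_on S (\<lambda>x. f x + g x)"
      using Suc.prems[THEN Ck_on_continuous[OF openin_subset[OF S]]] by (rule continuous_on_add)
    fix i assume i: "i < n"
    show "Ck_on n k S (\<lambda>x. partial_derivative i f x + partial_derivative i g x)"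
      using i Suc.prems by (intro Suc.IH Ck_on_SucD(1))
    fix x assume "x \<in> S"
    then show "((\<lambda>t. f (x(i := t)) + g (x(i := t))) has_field_derivative
           partial_derivative i f x + partial_derivative i g x) (at (x i))"
      by (intro DERIV_add Ck_on_SucD(2)[OF Suc.prems(1) i] Ck_on_SucD(2)[OF Suc.prems(2) i])
  qed
qed

lemma Ck_on_mult:
  assumes S: "openin (Euclidean_space n) S"
  shows "Ck_on n k S f \<Longrightarrow> Ck_on n k S g \<Longrightarrow> Ck_on n k S (\<lambda>x. f x * g x)"
proof (induction k arbitrary: f g)
  case 0
  then show ?case
    using openin_subset[OF S]
    by (auto simp: continuous_map_Euclidean_subtopology intro: continuous_intros)
next
  case (Suc k)
  show ?case
  proof (rule Ck_on_SucI[OF S, where g = "\<lambda>i x. partial_derivative i f x * g x + f x * partial_derivative i g x"])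
    show "continuous_on S (\<lambda>x. f x * g x)"
      using Suc.prems[THEN Ck_on_continuous[OF openin_subset[OF S]]] by (rule continuous_on_mult)
    fix i assume i: "i < n"
    show "Ck_on n k S (\<lambda>x. partial_derivative i f x * g x + f x * partial_derivative i g x)"
      by (intro Ck_on_add[OF S] Suc.IH Ck_on_SucD(1)[OF Suc.prems(1) i] Ck_on_SucD(1)[OF Suc.prems(2) i]
          Suc.prems[THEN Ck_on_Suc_imp])
    fix x assume "x \<in> S"
    then show "((\<lambda>t. f (x(i := t)) * g (x(i := t))) has_field_derivative
           partial_derivative i f x * g x + f x * partial_derivative i g x) (at (x i))"
      by (intro DERIV_cong[OF DERIV_mult[OF Ck_on_SucD(2)[OF Suc.prems(1) i] Ck_on_SucD(2)[OF Suc.prems(2) i]]])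
        (simp_all add: mult.commute)
  qed
qed

lemma Ck_on_sum:
  assumes S: "openin (Euclidean_space n) S" and "\<And>i. i \<in> I \<Longrightarrow> Ck_on n k S (f i)"
  shows "Ck_on n k S (\<lambda>x. \<Sum>i\<in>I. f i x)"
  using assms(2)
proof (induction I rule: infinite_finite_induct)
  case (insert i I)
  have "Ck_on n k S (\<lambda>x. f i x + (\<Sum>i\<in>I. f i x))"
    by (intro Ck_on_add[OF S] insert.IH insert.prems insertI1 insertI2)
  then show ?case
    using insert.hyps by simp
qed (simp_all add: Ck_on_const[OF S])

lemma Ck_on_prod:
  assumes S: "openin (Euclidean_space n) S" and "\<And>i. i \<in> I \<Longrightarrow> Ck_on n k S (f i)"
  shows "Ck_on n k S (\<lambda>x. \<Prod>i\<in>I. f i x)"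
  using assms(2)
proof (induction I rule: infinite_finite_induct)
  case (insert i I)
  have "Ck_on n k S (\<lambda>x. f i x * (\<Prod>i\<in>I. f i x))"
    by (intro Ck_on_mult[OF S] insert.IH insert.prems insertI1 insertI2)
  then show ?case
    using insert.hyps by simp
qed (simp_all add: Ck_on_const[OF S])

section \<open>Coordinate boxes, Hadamard's formula and the chain rule\<close>

text \<open>Open balls of n-space for the maximum norm. Being products of intervals, they contain
  every axis-parallel path between two of their points that moves monotonically, and they carry bump
  functions that are products of one-variable functions.\<close>

definition coord_box :: "nat \<Rightarrow> (nat \<Rightarrow> real) \<Rightarrow> real \<Rightarrow> (nat \<Rightarrow> real) set" where
  "coord_box n c r = {x \<in> topspace (Euclidean_space n). \<forall>i<n. \<bar>x i - c i\<bar> < r}"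

lemma open_coord_bounds: "open {x::nat \<Rightarrow> real. \<forall>i<n. \<bar>x i - c i\<bar> < r}"
proof -
  have "open (\<Inter>i\<in>{..<n}. {x::nat \<Rightarrow> real. \<bar>x i - c i\<bar> < r})"
    by (intro open_INT ballI open_Collect_less continuous_on_const continuous_on_rabs continuous_on_diff
        continuous_on_coord finite_lessThan)
  moreover have "(\<Inter>i\<in>{..<n}. {x::nat \<Rightarrow> real. \<bar>x i - c i\<bar> < r}) = {x. \<forall>i<n. \<bar>x i - c i\<bar> < r}"
    by auto
  ultimately show ?thesis by simp
qed

lemma openin_Euclidean_space_iff:
  "openin (Euclidean_space n) S \<longleftrightarrow> (\<exists>W. open W \<and> S = topspace (Euclidean_space n) \<inter> W)"
  by (subst Euclidean_space_eq_top_of_set) (rule openin_open)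

lemma openin_coord_box: "openin (Euclidean_space n) (coord_box n c r)"
  unfolding openin_Euclidean_space_iff
  by (rule exI[of _ "{x. \<forall>i<n. \<bar>x i - c i\<bar> < r}"]) (auto simp: open_coord_bounds coord_box_def)

lemma coord_box_subset: "coord_box n c r \<subseteq> topspace (Euclidean_space n)"
  by (auto simp: coord_box_def)

lemma openin_contains_coord_box:
  assumes S: "openin (Euclidean_space n) S" and x: "x \<in> S"
  obtains r where "r > 0" "coord_box n x r \<subseteq> S"
proof -
  obtain W where W: "open W" "S = topspace (Euclidean_space n) \<inter> W"
    using S openin_Euclidean_space_iff by metis
  have "openin (product_topology (\<lambda>i. euclidean) UNIV) W"
    using W(1) by (simp add: euclidean_product_topology)
  moreover have "x \<in> W"
    using W x by blast
  ultimately obtain X where X: "x \<in> (\<Pi>\<^sub>E i\<in>UNIV. X i)" "\<And>i. open (X i)" "(\<Pi>\<^sub>E i\<in>UNIV. X i) \<subseteq> W"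
    using product_topology_open_contains_basis[of "\<lambda>i. euclidean" UNIV W x] by (metis open_openin)
  have "\<exists>e>0. \<forall>t. \<bar>t - x i\<bar> < e \<longrightarrow> t \<in> X i" for i
    using X(2)[of i] X(1) unfolding open_dist dist_real_def by auto
  then obtain e where e: "\<And>i. e i > 0" "\<And>i t. \<bar>t - x i\<bar> < e i \<Longrightarrow> t \<in> X i"
    by metis
  \<comment> \<open>The extra element 1 keeps the set nonempty when \<open>n = 0\<close>.\<close>
  define r where "r = Min (insert 1 (e ` {..<n}))"
  have "r > 0"
    unfolding r_def using e(1) by (subst Min_gr_iff) auto
  have re: "r \<le> e i" if "i < n" for i
    unfolding r_def using that by (intro Min_le) auto
  have "y \<in> W" if y: "y \<in> coord_box n x r" for y
  proof -
    have "y i \<in> X i" for i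
    proof (cases "i < n")
      case True
      then have "\<bar>y i - x i\<bar> < e i"
        using y re by (force simp: coord_box_def)
      then show ?thesis by (rule e(2))
    next
      case False
      then have "y i = x i"
        using y openin_subset[OF S] x by (auto simp: coord_box_def topspace_Euclidean_space)
      then show ?thesis
        using X(1) by auto
    qed
    then show ?thesis
      using X(3) by auto
  qed
  then have "coord_box n x r \<subseteq> S"
    using W(2) coord_box_subset by blast
  with \<open>r > 0\<close> show ?thesis by (rule that)
qed

text \<open>Stronger than convexity: each coordinate has its own weight \<open>a l\<close>, which a
  product of intervals allows. Coordinates from \<open>n\<close> on vanish at both points and stay
  zero.\<close>

lemma coord_box_convex:
  assumes "z \<in> coord_box n c r" "y \<in> coord_box n c r" "\<And>l. 0 \<le> a l \<and> a l \<le> 1"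
  shows "(\<lambda>l. z l + a l * (y l - z l)) \<in> coord_box n c r"
proof -
  have "\<bar>z l + a l * (y l - z l) - c l\<bar> < r" if "l < n" for l
  proof -
    have "z l + a l * (y l - z l) = (1 - a l) * z l + a l * y l"
      by (simp add: algebra_simps)
    moreover have "z l \<in> ball (c l) r" "y l \<in> ball (c l) r"
      using assms(1,2) that by (auto simp: coord_box_def dist_real_def abs_minus_commute)
    ultimately have "z l + a l * (y l - z l) \<in> ball (c l) r"
      using convexD[OF convex_ball, of "z l" "c l" r "y l" "1 - a l" "a l"] assms(3)[of l] by simp
    then show ?thesis
      by (simp add: dist_real_def abs_minus_commute)
  qed
  then show ?thesis
    using assms(1,2) by (auto simp: coord_box_def topspace_Euclidean_space)
qed

text \<open>Differentiation under the integral sign. A derivative in direction \<open>i\<close>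
  produces the inner factor \<open>a i s\<close>; the weight \<open>w\<close> is there to absorb it,
  so that the induction reproduces an integral of the same shape.\<close>

lemma Ck_on_integral_dilation:
  fixes a :: "nat \<Rightarrow> real \<Rightarrow> real"
  assumes z: "z \<in> coord_box n c r"
    and a: "\<And>l. continuous_on {0..1} (a l)" "\<And>l s. s \<in> {0..1} \<Longrightarrow> 0 \<le> a l s \<and> a l s \<le> 1"
  shows "continuous_on {0..1} w \<Longrightarrow> Ck_on n k (coord_box n c r) g \<Longrightarrow>
    Ck_on n k (coord_box n c r) (\<lambda>y. integral {0..1} (\<lambda>s. w s * g (\<lambda>l. z l + a l s * (y l - z l))))"
proof (induction k arbitrary: g w)
  let ?S = "coord_box n c r"
  note S = openin_coord_box[of n c r]
  have in_S: "(\<lambda>l. z l + a l s * (y l - z l)) \<in> ?S" if "y \<in> ?S" "s \<in> {0..1}" for y s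
    by (rule coord_box_convex[OF z that(1)]) (rule a(2)[OF that(2)])
  have contw: "continuous_on (?S \<times> {0..1}) (\<lambda>(y, s). w s * g (\<lambda>l. z l + a l s * (y l - z l)))"
    if w: "continuous_on {0..1} w" and g: "continuous_on ?S g"
    for g :: "(nat \<Rightarrow> real) \<Rightarrow> real" and w :: "real \<Rightarrow> real"
  proof -
    have "continuous_on (?S \<times> {0..1}) (\<lambda>p l. z l + a l (snd p) * (fst p l - z l))"
    proof (rule continuous_on_coordinatewise_then_product)
      fix l
      have "continuous_on (?S \<times> {0..1}) (\<lambda>p. a l (snd p))"
        by (rule continuous_on_compose2[OF a(1) continuous_on_snd[OF continuous_on_id]]) auto
      moreover have "continuous_on (?S \<times> {0..1}) (\<lambda>p. fst p l)"
        by (rule continuous_on_compose2[OF continuous_on_coord continuous_on_fst[OF continuous_on_id]]) auto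
      ultimately show "continuous_on (?S \<times> {0..1}) (\<lambda>p. z l + a l (snd p) * (fst p l - z l))"
        by (intro continuous_on_add continuous_on_mult continuous_on_diff continuous_on_const)
    qed
    then have "continuous_on (?S \<times> {0..1}) (\<lambda>p. g (\<lambda>l. z l + a l (snd p) * (fst p l - z l)))"
      by (rule continuous_on_compose2[OF g]) (use in_S in auto)
    moreover have "continuous_on (?S \<times> {0..1}) (\<lambda>p. w (snd p))"
      by (rule continuous_on_compose2[OF w continuous_on_snd[OF continuous_on_id]]) auto
    ultimately show ?thesis
      using continuous_on_mult[of "?S \<times> {0..1}" "\<lambda>p. w (snd p)" "\<lambda>p. g (\<lambda>l. z l + a l (snd p) * (fst p l - z l))"]
      by (simp add: split_beta)
  qed
  have cont_int: "continuous_on ?S (\<lambda>y. integral {0..1} (\<lambda>s. w s * g (\<lambda>l. z l + a l s * (y l - z l))))"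
    if w: "continuous_on {0..1} w" and g: "continuous_on ?S g"
    for g :: "(nat \<Rightarrow> real) \<Rightarrow> real" and w :: "real \<Rightarrow> real"
    using integral_continuous_on_param[of ?S 0 "1::real"
        "\<lambda>y s. w s * g (\<lambda>l. z l + a l s * (y l - z l))"] contw[OF w g] by simp
  {
    case 0
    then show ?case
      using cont_int by (simp add: continuous_map_Euclidean_subtopology[OF coord_box_subset])
  next
    case (Suc k)
    have cg: "continuous_on ?S g"
      by (rule Ck_on_continuous[OF coord_box_subset Suc.prems(2)])
    show ?case
    proof (rule Ck_on_SucI[OF S, where g = "\<lambda>i y. integral {0..1}
          (\<lambda>s. (w s * a i s) * partial_derivative i g (\<lambda>l. z l + a l s * (y l - z l)))"])
      show "continuous_on ?S (\<lambda>y. integral {0..1} (\<lambda>s. w s * g (\<lambda>l. z l + a l s * (y l - z l))))"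
        by (rule cont_int[OF Suc.prems(1) cg])
      fix i assume i: "i < n"
      \<comment> \<open>The new weight, with the chain rule factor of direction \<open>i\<close>
        included.\<close>
      have w': "continuous_on {0..1} (\<lambda>s. w s * a i s)"
        by (intro continuous_on_mult Suc.prems(1) a(1))
      show "Ck_on n k ?S (\<lambda>y. integral {0..1}
          (\<lambda>s. (w s * a i s) * partial_derivative i g (\<lambda>l. z l + a l s * (y l - z l))))"
        by (rule Suc.IH[OF w' Ck_on_SucD(1)[OF Suc.prems(2) i]])
      fix y assume y: "y \<in> ?S"
      \<comment> \<open>The interval in which coordinate \<open>i\<close> can vary without leaving
        the box. It is open, so the derivative within it is the full derivative.\<close>
      let ?U = "ball (c i) r"
      let ?M = "\<lambda>t s l. z l + a l s * ((y(i := t)) l - z l)"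
      have U: "y(i := t) \<in> ?S" if "t \<in> ?U" for t
        using y that i by (auto simp: coord_box_def topspace_Euclidean_space dist_real_def abs_minus_commute)
      have cont_upd: "continuous_on (?U \<times> {0..1}) (\<lambda>(t, s). v s * h (?M t s))"
        if "continuous_on {0..1} v" "continuous_on ?S h"
        for h :: "(nat \<Rightarrow> real) \<Rightarrow> real" and v :: "real \<Rightarrow> real"
      proof -
        have "continuous_on (?U \<times> {0..1}) (\<lambda>p. (y(i := fst p), snd p))"
          by (intro continuous_on_Pair continuous_on_snd continuous_on_id
              continuous_on_compose2[OF continuous_on_fun_upd[of UNIV] continuous_on_fst[OF continuous_on_id]]) auto
        then have "continuous_on (?U \<times> {0..1})
            (\<lambda>p. (case (y(i := fst p), snd p) of (y, s) \<Rightarrow> v s * h (\<lambda>l. z l + a l s * (y l - z l))))"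
          by (rule continuous_on_compose2[OF contw[OF that]]) (use U in auto)
        then show ?thesis
          by (simp add: split_beta)
      qed
      have "((\<lambda>t. integral (cbox 0 1) (\<lambda>s. w s * g (?M t s))) has_field_derivative
          integral (cbox 0 1) (\<lambda>s. (w s * a i s) * partial_derivative i g (?M (y i) s))) (at (y i) within ?U)"
      proof (rule leibniz_rule_field_derivative)
        show "y i \<in> ?U"
          using y i by (auto simp: coord_box_def dist_real_def abs_minus_commute)
        show "continuous_on (?U \<times> cbox 0 1) (\<lambda>(t, s). (w s * a i s) * partial_derivative i g (?M t s))"
          using cont_upd[OF w' Ck_on_continuous[OF coord_box_subset Ck_on_SucD(1)[OF Suc.prems(2) i]]] by simp
        show "(\<lambda>s. w s * g (?M t s)) integrable_on cbox 0 1" if t: "t \<in> ?U" for t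
        proof -
          have "continuous_on {0..1} (\<lambda>s. (case (t, s) of (t, s) \<Rightarrow> w s * g (?M t s)))"
            by (rule continuous_on_compose2[OF cont_upd[OF Suc.prems(1) cg]]) (use t in \<open>auto intro!: continuous_intros\<close>)
          then show ?thesis
            by (simp add: integrable_continuous_real)
        qed
        fix t s :: real assume t: "t \<in> ?U" and s: "s \<in> cbox 0 1"
        let ?q = "\<lambda>l. z l + a l s * (y l - z l)"
        \<comment> \<open>Changing coordinate \<open>i\<close> of \<open>y\<close> moves only
          coordinate \<open>i\<close> of the dilated point, and affinely; the one-variable chain
          rule is therefore enough.\<close>
        have M: "?M t s = ?q(i := z i + a i s * (t - z i))" for t
          by auto
        have "?q(i := z i + a i s * (t - z i)) \<in> ?S"
          using in_S[OF U[OF t], of s] s M[of t] by simp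
        from Ck_on_SucD_at[OF Suc.prems(2) i this]
        have "((\<lambda>t. g (?q(i := t))) has_field_derivative partial_derivative i g (?M t s)) (at (z i + a i s * (t - z i)))"
          unfolding M .
        moreover have "((\<lambda>t. z i + a i s * (t - z i)) has_field_derivative a i s) (at t)"
          by (auto intro!: derivative_eq_intros)
        ultimately have "((\<lambda>t. g (?q(i := z i + a i s * (t - z i)))) has_field_derivative
            partial_derivative i g (?M t s) * a i s) (at t)"
          by (rule DERIV_chain2)
        then have "((\<lambda>t. g (?M t s)) has_field_derivative partial_derivative i g (?M t s) * a i s) (at t within ?U)"
          unfolding M by (rule has_field_derivative_at_within)
        from DERIV_cmult[OF this, of "w s"]
        show "((\<lambda>t. w s * g (?M t s)) has_field_derivative (w s * a i s) * partial_derivative i g (?M t s)) (at t within ?U)"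
          by (simp only: mult_ac)
      qed simp
      moreover have "at (y i) within ?U = at (y i)"
        by (rule at_within_open) (use y i in \<open>auto simp: coord_box_def dist_real_def abs_minus_commute\<close>)
      ultimately show "((\<lambda>t. integral {0..1} (\<lambda>s. w s * g (\<lambda>l. z l + a l s * ((y(i := t)) l - z l)))) has_field_derivative
          integral {0..1} (\<lambda>s. (w s * a i s) * partial_derivative i g (\<lambda>l. z l + a l s * (y l - z l)))) (at (y i))"
        by (simp only: fun_upd_triv cbox_interval)
    qed
  }
qed

text \<open>The path from \<open>z\<close> to \<open>y\<close> runs along the coordinate directions one after the other, so that only
  one-variable calculus is needed.\<close>

definition hadamard_coeff ::
    "((nat \<Rightarrow> real) \<Rightarrow> real) \<Rightarrow> (nat \<Rightarrow> real) \<Rightarrow> nat \<Rightarrow> (nat \<Rightarrow> real) \<Rightarrow> real" where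
  "hadamard_coeff f z j y = integral {0..1} (\<lambda>s. 1 * partial_derivative j f
     (\<lambda>l. z l + (if l < j then 1 else if l = j then s else 0) * (y l - z l)))"

text \<open>The dilation lemma with weights 1, \<open>s\<close> and 0 before, at and after index
  \<open>j\<close>; the factor 1 in the definition is its initial weight. One order is lost to the
  partial derivative under the integral.\<close>

lemma Ck_on_hadamard_coeff:
  assumes "z \<in> coord_box n c r" "Ck_on n (Suc k) (coord_box n c r) f" "j < n"
  shows "Ck_on n k (coord_box n c r) (hadamard_coeff f z j)"
  unfolding hadamard_coeff_def
proof (rule Ck_on_integral_dilation[OF assms(1)])
  fix l
  show "continuous_on {0..1} (\<lambda>s::real. if l < j then 1 else if l = j then s else 0)"
    by (cases "l < j"; cases "l = j") auto
qed (use Ck_on_SucD(1)[OF assms(2,3)] in auto)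

text \<open>For \<open>y = z\<close> the path is constant, hence so is the integrand. This
  identifies Hadamard coefficients at the base point with coordinate derivatives.\<close>

lemma hadamard_coeff_same: "hadamard_coeff f z j z = partial_derivative j f z"
  by (simp add: hadamard_coeff_def)

text \<open>The increment of \<open>f\<close> telescopes over the corners \<open>p j\<close> of the
  axis-parallel path, and the fundamental theorem of calculus evaluates each edge.\<close>

lemma hadamard:
  assumes z: "z \<in> coord_box n c r" and f: "Ck_on n (Suc k) (coord_box n c r) f" and y: "y \<in> coord_box n c r"
  shows "f y = f z + (\<Sum>j<n. (y j - z j) * hadamard_coeff f z j y)"
proof -
  define p where "p = (\<lambda>j l. if l < j then y l else z l)"
  have "f (p (Suc j)) - f (p j) = (y j - z j) * hadamard_coeff f z j y" if j: "j < n" for j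
  proof -
    let ?q = "\<lambda>s. (p j)(j := z j + s * (y j - z j))"
    have q: "?q s = (\<lambda>l. z l + (if l < j then 1 else if l = j then s else 0) * (y l - z l))" for s
      by (auto simp: p_def fun_eq_iff)
    have der: "((\<lambda>s. f (?q s)) has_field_derivative partial_derivative j f (?q s) * (y j - z j)) (at s)"
      if s: "s \<in> {0..1}" for s
    proof -
      have "?q s \<in> coord_box n c r"
        unfolding q by (rule coord_box_convex[OF z y]) (use s in auto)
      from Ck_on_SucD_at[OF f j this] show ?thesis
        by (rule DERIV_chain2) (auto intro!: derivative_eq_intros)
    qed
    have "((\<lambda>s. partial_derivative j f (?q s) * (y j - z j)) has_integral f (?q 1) - f (?q 0)) {0..1}"
      by (rule fundamental_theorem_of_calculus)
        (simp_all only: zero_le_one has_real_derivative_iff_has_vector_derivative[symmetric] has_field_derivative_at_within[OF der])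
    then have "f (?q 1) - f (?q 0) = integral {0..1} (\<lambda>s. partial_derivative j f (?q s) * (y j - z j))"
      by (simp only: integral_unique)
    also have "\<dots> = integral {0..1} (\<lambda>s. partial_derivative j f (?q s)) * (y j - z j)"
      by (rule integral_mult_left)
    finally have "f (?q 1) - f (?q 0) = (y j - z j) * hadamard_coeff f z j y"
      unfolding hadamard_coeff_def q by (simp add: mult.commute)
    moreover have "?q 1 = p (Suc j)" "?q 0 = p j"
      by (auto simp: p_def fun_eq_iff)
    ultimately show ?thesis by simp
  qed
  then have "(\<Sum>j<n. (y j - z j) * hadamard_coeff f z j y) = (\<Sum>j<n. f (p (Suc j)) - f (p j))"
    by (intro sum.cong) auto
  also have "\<dots> = f (p n) - f (p 0)"
    by (rule sum_lessThan_telescope)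
  \<comment> \<open>After \<open>n\<close> edges all of \<open>y\<close> is reached, because
    \<open>y\<close> and \<open>z\<close> both vanish from index \<open>n\<close> on.\<close>
  also have "p n = y"
    using y z by (auto simp: p_def fun_eq_iff coord_box_def topspace_Euclidean_space)
  also have "p 0 = z"
    by (simp add: p_def)
  finally show ?thesis by simp
qed

text \<open>Divide Hadamard's formula at \<open>F t0\<close> by \<open>t - t0\<close>: the quotients
  of coordinates tend to \<open>F' j\<close>, and the coefficients, being continuous, tend to the
  partial derivatives.\<close>

lemma chain_rule_curve:
  assumes T: "openin (Euclidean_space m) T" and f: "Ck_on m (Suc 0) T f"
    and N: "open N" "t0 \<in> N" and F: "continuous_on N F" "F ` N \<subseteq> T"
    and F': "\<And>j. j < m \<Longrightarrow> ((\<lambda>t. F t j) has_field_derivative F' j) (at t0)"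
  shows "((\<lambda>t. f (F t)) has_field_derivative (\<Sum>j<m. partial_derivative j f (F t0) * F' j)) (at t0)"
proof -
  define z where "z = F t0"
  have "z \<in> T" using F N by (auto simp: z_def)
  then obtain r where r: "r > 0" "coord_box m z r \<subseteq> T"
    using openin_contains_coord_box[OF T] by metis
  have z: "z \<in> coord_box m z r"
    using \<open>z \<in> T\<close> openin_subset[OF T] r(1) by (auto simp: coord_box_def)
  have fB: "Ck_on m (Suc 0) (coord_box m z r) f"
    by (rule Ck_on_subset[OF f r(2)])
  \<comment> \<open>Restricts the parameter so that the curve stays in the box where Hadamard's
    formula holds.\<close>
  define N' where "N' = N \<inter> F -` {x. \<forall>i<m. \<bar>x i - z i\<bar> < r}"
  have N': "open N'" "t0 \<in> N'"
    unfolding N'_def using N continuous_open_preimage[OF F(1) N(1) open_coord_bounds] z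
    by (auto simp: z_def coord_box_def)
  have FN': "F t \<in> coord_box m z r" if "t \<in> N'" for t
    using that F(2) openin_subset[OF T] by (auto simp: N'_def coord_box_def)
  have h: "((\<lambda>t. hadamard_coeff f z j (F t)) \<longlongrightarrow> partial_derivative j f z) (at t0)" if j: "j < m" for j
  proof -
    have "continuous_on (coord_box m z r) (hadamard_coeff f z j)"
      by (rule Ck_on_continuous[OF coord_box_subset Ck_on_hadamard_coeff[OF z fB j]])
    moreover have "continuous_on N' F"
      by (rule continuous_on_subset[OF F(1)]) (auto simp: N'_def)
    ultimately have "continuous_on N' (\<lambda>t. hadamard_coeff f z j (F t))"
      by (rule continuous_on_compose2) (use FN' in auto)
    then have "isCont (\<lambda>t. hadamard_coeff f z j (F t)) t0"
      using N' by (simp add: continuous_on_eq_continuous_at)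
    then show ?thesis
      by (simp add: isCont_def z_def hadamard_coeff_same)
  qed
  have "((\<lambda>t. \<Sum>j<m. ((F t j - z j) / (t - t0)) * hadamard_coeff f z j (F t)) \<longlongrightarrow>
      (\<Sum>j<m. F' j * partial_derivative j f z)) (at t0)"
    using F' h by (intro tendsto_sum tendsto_mult) (auto simp: has_field_derivative_iff z_def)
  moreover have "\<forall>\<^sub>F t in at t0. (\<Sum>j<m. ((F t j - z j) / (t - t0)) * hadamard_coeff f z j (F t)) = (f (F t) - f z) / (t - t0)"
  proof -
    have "\<forall>\<^sub>F t in at t0. t \<in> N'"
      by (rule eventually_at_in_open'[OF N'])
    then show ?thesis
    proof eventually_elim
      case (elim t)
      show ?case
        using hadamard[OF z fB FN'[OF elim]] by (simp add: sum_divide_distrib)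
    qed
  qed
  ultimately show ?thesis
    unfolding has_field_derivative_iff z_def[symmetric]
    by (subst mult.commute) (rule Lim_transform_eventually)
qed

lemma continuous_on_into_Euclidean_space:
  assumes "G ` S \<subseteq> topspace (Euclidean_space m)" "\<And>j. j < m \<Longrightarrow> continuous_on S (\<lambda>x. G x j)"
  shows "continuous_on S G"
proof (rule continuous_on_coordinatewise_then_product)
  fix j
  show "continuous_on S (\<lambda>x. G x j)"
  proof (cases "j < m")
    case False
    then have "continuous_on S (\<lambda>x. G x j) \<longleftrightarrow> continuous_on S (\<lambda>x. 0::real)"
      using assms(1) by (intro continuous_on_cong) (auto simp: topspace_Euclidean_space)
    then show ?thesis by simp
  qed (rule assms(2))
qed

text \<open>The chain rule writes the partial derivatives as sums of products in which
  \<open>f\<close> enters through \<open>partial_derivative j f\<close>, one order lower. Hence the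
  induction varies \<open>f\<close> and keeps \<open>G\<close> fixed.\<close>

lemma Ck_on_compose:
  assumes S: "openin (Euclidean_space n) S" and T: "openin (Euclidean_space m) T" and GS: "G ` S \<subseteq> T"
  shows "(\<And>j. j < m \<Longrightarrow> Ck_on n k S (\<lambda>x. G x j)) \<Longrightarrow> Ck_on m k T f \<Longrightarrow> Ck_on n k S (\<lambda>x. f (G x))"
proof (induction k arbitrary: f)
  have contG: "continuous_on S G" if "\<And>j. j < m \<Longrightarrow> Ck_on n k S (\<lambda>x. G x j)" for k
    using that GS openin_subset[OF T]
    by (intro continuous_on_into_Euclidean_space[where m = m] Ck_on_continuous[OF openin_subset[OF S]]) auto
  have contf: "continuous_on S (\<lambda>x. f (G x))"
    if "\<And>j. j < m \<Longrightarrow> Ck_on n k S (\<lambda>x. G x j)" "Ck_on m k T f" for k f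
    by (rule continuous_on_compose2[OF Ck_on_continuous[OF openin_subset[OF T] that(2)] contG[OF that(1)] GS])
  {
    case 0
    from contf[OF this] show ?case
      by (simp add: continuous_map_Euclidean_subtopology[OF openin_subset[OF S]])
  next
    case (Suc k)
    have f1: "Ck_on m (Suc 0) T f"
      using Suc.prems(2) by (induction k) (auto dest: Ck_on_Suc_imp)
    show ?case
    proof (rule Ck_on_SucI[OF S, where g = "\<lambda>i x. \<Sum>j<m. partial_derivative j f (G x) * partial_derivative i (\<lambda>x. G x j) x"])
      show "continuous_on S (\<lambda>x. f (G x))"
        by (rule contf[OF Suc.prems])
      fix i assume i: "i < n"
      have "Ck_on n k S (\<lambda>x. partial_derivative j f (G x))" if "j < m" for j
        by (rule Suc.IH[OF Ck_on_Suc_imp[OF Suc.prems(1)] Ck_on_SucD(1)[OF Suc.prems(2) that]])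
      then show "Ck_on n k S (\<lambda>x. \<Sum>j<m. partial_derivative j f (G x) * partial_derivative i (\<lambda>x. G x j) x)"
        by (intro Ck_on_sum[OF S] Ck_on_mult[OF S] Ck_on_SucD(1)[OF Suc.prems(1) i]) auto
      fix x assume x: "x \<in> S"
      then have xE: "x \<in> topspace (Euclidean_space n)"
        using openin_subset[OF S] by blast
      have "((\<lambda>t. f (G (x(i := t)))) has_field_derivative
          (\<Sum>j<m. partial_derivative j f (G (x(i := x i))) * partial_derivative i (\<lambda>x. G x j) x)) (at (x i))"
      proof (rule chain_rule_curve[OF T f1 open_Collect_fun_upd[OF S xE i]])
        show "continuous_on {t. x(i := t) \<in> S} (\<lambda>t. G (x(i := t)))"
          by (rule continuous_on_compose2[OF contG[OF Suc.prems(1)] continuous_on_fun_upd]) auto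
        show "((\<lambda>t. G (x(i := t)) j) has_field_derivative partial_derivative i (\<lambda>x. G x j) x) (at (x i))"
          if "j < m" for j
          by (rule Ck_on_SucD(2)[OF Suc.prems(1)[OF that] i x])
      qed (use x GS in auto)
      then show "((\<lambda>t. f (G (x(i := t)))) has_field_derivative
          (\<Sum>j<m. partial_derivative j f (G x) * partial_derivative i (\<lambda>x. G x j) x)) (at (x i))"
        by simp
    qed
  }
qed

text \<open>The outer function comes with the whole sequence \<open>D\<close> of its successive
  derivatives, required only at values of \<open>f\<close>. The induction then just shifts the index
  \<open>j\<close>.\<close>

lemma Ck_on_compose_real:
  assumes S: "openin (Euclidean_space n) S"
    and D: "\<And>j x. x \<in> S \<Longrightarrow> (D j has_field_derivative D (Suc j) (f x)) (at (f x))"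
  shows "Ck_on n k S f \<Longrightarrow> Ck_on n k S (\<lambda>x. D j (f x))"
proof (induction k arbitrary: j)
  have cont: "continuous_on S (\<lambda>x. D j (f x))" if "Ck_on n k S f" for j k
  proof -
    have "continuous_on (f ` S) (D j)"
      using D by (auto intro!: continuous_at_imp_continuous_on DERIV_isCont)
    then show ?thesis
      by (rule continuous_on_compose2[OF _ Ck_on_continuous[OF openin_subset[OF S] that]]) auto
  qed
  {
    case 0
    from cont[OF this] show ?case
      by (simp add: continuous_map_Euclidean_subtopology[OF openin_subset[OF S]])
  next
    case (Suc k)
    show ?case
    proof (rule Ck_on_SucI[OF S, where g = "\<lambda>i x. D (Suc j) (f x) * partial_derivative i f x"])
      show "continuous_on S (\<lambda>x. D j (f x))"
        by (rule cont[OF Suc.prems])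
      fix i assume i: "i < n"
      show "Ck_on n k S (\<lambda>x. D (Suc j) (f x) * partial_derivative i f x)"
        by (intro Ck_on_mult[OF S] Suc.IH Ck_on_Suc_imp[OF Suc.prems] Ck_on_SucD(1)[OF Suc.prems i])
      fix x assume x: "x \<in> S"
      have "(D j has_field_derivative D (Suc j) (f x)) (at (f (x(i := x i))))"
        using D[OF x] by simp
      from DERIV_chain2[OF this Ck_on_SucD(2)[OF Suc.prems i x]]
      show "((\<lambda>t. D j (f (x(i := t)))) has_field_derivative D (Suc j) (f x) * partial_derivative i f x) (at (x i))" .
    qed
  }
qed

lemma Ck_on_inverse:
  assumes S: "openin (Euclidean_space n) S" and nz: "\<And>x. x \<in> S \<Longrightarrow> f x \<noteq> 0" and f: "Ck_on n k S f"
  shows "Ck_on n k S (\<lambda>x. inverse (f x))"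
proof -
  \<comment> \<open>The \<open>j\<close>-th derivative of 1/t is (-1)^j j! / t^(j+1).\<close>
  define D where "D = (\<lambda>j t::real. (-1) ^ j * fact j * inverse t ^ Suc j)"
  have "(D j has_field_derivative D (Suc j) (f x)) (at (f x))" if "x \<in> S" for j x
    unfolding D_def using nz[OF that]
    by (intro DERIV_cong[OF DERIV_cmult[OF DERIV_power[OF DERIV_inverse]]]) (simp_all add: algebra_simps)
  from Ck_on_compose_real[where D = D and j = 0, OF S this f] show ?thesis
    by (simp add: D_def)
qed

section \<open>Flat exponentials and bump functions on boxes\<close>

lemma Ck_on_uminus: "openin (Euclidean_space n) S \<Longrightarrow> Ck_on n k S f \<Longrightarrow> Ck_on n k S (\<lambda>x. - f x)"
  using Ck_on_mult[of n S k "\<lambda>_. -1" f] Ck_on_const[of n S k "-1"] by simp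

text \<open>For \<open>P = 1\<close> this is the classical smooth function exp(-1/t) extended by 0.
  Admitting a polynomial in 1/t as a factor makes the family closed under differentiation.\<close>

definition flat_exp :: "real poly \<Rightarrow> real \<Rightarrow> real" where
  "flat_exp P t = (if t > 0 then poly P (inverse t) * exp (- inverse t) else 0)"

lemma poly_times_exp_minus_tendsto_0: "((\<lambda>s::real. poly P s * exp (- s)) \<longlongrightarrow> 0) at_top"
proof -
  have "((\<lambda>s::real. \<Sum>i\<le>degree P. coeff P i * (s ^ i / exp s)) \<longlongrightarrow> (\<Sum>i\<le>degree P. coeff P i * 0)) at_top"
    by (intro tendsto_sum tendsto_mult tendsto_const tendsto_power_div_exp_0)
  moreover have "(\<Sum>i\<le>degree P. coeff P i * (s ^ i / exp s)) = poly P s * exp (- s)" for s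
    by (simp add: poly_altdef sum_distrib_right exp_minus divide_inverse mult.assoc)
  ultimately show ?thesis by simp
qed

text \<open>For positive t, the derivative of P(1/t) exp(-1/t) is t^(-2) (P - P')(1/t) exp(-1/t);
  the factor t^(-2) is the polynomial \<open>[:0, 0, 1:]\<close> evaluated at 1/t.\<close>

lemma flat_exp_DERIV:
  "(flat_exp P has_field_derivative flat_exp ([:0, 0, 1:] * (P - pderiv P)) t) (at t)"
proof -
  consider "t > 0" | "t < 0" | "t = 0" by linarith
  then show ?thesis
  proof cases
    case 1
    then have "((\<lambda>t. poly P (inverse t) * exp (- inverse t)) has_field_derivative
        flat_exp ([:0, 0, 1:] * (P - pderiv P)) t) (at t)"
      by (auto intro!: derivative_eq_intros DERIV_chain2[OF poly_DERIV] simp: flat_exp_def algebra_simps)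
    moreover have "\<forall>\<^sub>F x in nhds t. x > 0"
      using 1 by (intro eventually_nhds_in_open[of "{0<..}", simplified]) auto
    then have "\<forall>\<^sub>F x in nhds t. poly P (inverse x) * exp (- inverse x) = flat_exp P x"
      by eventually_elim (simp add: flat_exp_def)
    ultimately show ?thesis
      using 1 by (subst (asm) DERIV_cong_ev[OF refl]) auto
  next
    case 2
    have "((\<lambda>t. 0) has_field_derivative flat_exp ([:0, 0, 1:] * (P - pderiv P)) t) (at t)"
      using 2 by (simp add: flat_exp_def)
    moreover have "\<forall>\<^sub>F x in nhds t. x < 0"
      using 2 by (intro eventually_nhds_in_open[of "{..<0}", simplified]) auto
    then have "\<forall>\<^sub>F x in nhds t. 0 = flat_exp P x"
      by eventually_elim (simp add: flat_exp_def)
    ultimately show ?thesis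
      using 2 by (subst (asm) DERIV_cong_ev[OF refl]) auto
  next
    case 3
    \<comment> \<open>The difference quotient at 0 from the right: dividing by \<open>x\<close>
      multiplies the polynomial in 1/x by its variable, and exponential decay still wins.\<close>
    have "((\<lambda>x. poly (pCons 0 P) (inverse x) * exp (- inverse x)) \<longlongrightarrow> 0) (at_right 0)"
      by (rule filterlim_compose[OF poly_times_exp_minus_tendsto_0 filterlim_inverse_at_top_right])
    moreover have "\<forall>\<^sub>F x in at_right 0. poly (pCons 0 P) (inverse x) * exp (- inverse x) = flat_exp P x / x"
      by (auto simp: flat_exp_def eventually_at_filter divide_inverse)
    ultimately have "((\<lambda>x. flat_exp P x / x) \<longlongrightarrow> 0) (at_right 0)"
      by (rule Lim_transform_eventually)
    moreover have "((\<lambda>x. flat_exp P x / x) \<longlongrightarrow> 0) (at_left 0)"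
      by (rule tendsto_eventually) (auto simp: flat_exp_def eventually_at_filter)
    ultimately have "((\<lambda>x. flat_exp P x / x) \<longlongrightarrow> 0) (at 0)"
      by (simp add: filterlim_split_at)
    then show ?thesis
      using 3 by (simp add: has_field_derivative_iff flat_exp_def)
  qed
qed

lemma Ck_on_flat_exp:
  assumes S: "openin (Euclidean_space n) S" and f: "Ck_on n k S f"
  shows "Ck_on n k S (\<lambda>x. flat_exp 1 (f x))"
proof -
  \<comment> \<open>Iterates of the operator on polynomials that represents differentiation, started
    at the constant polynomial 1.\<close>
  define D where "D = (\<lambda>j. flat_exp (((\<lambda>P. [:0, 0, 1:] * (P - pderiv P)) ^^ j) 1))"
  have "(D j has_field_derivative D (Suc j) (f x)) (at (f x))" for j x
    unfolding D_def using flat_exp_DERIV by simp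
  from Ck_on_compose_real[where D = D and j = 0, OF S this f] show ?thesis
    by (simp add: D_def)
qed

text \<open>Each pair of factors is positive exactly for \<open>x i\<close> in the open interval of
  radius \<open>r\<close> around \<open>c i\<close>. Differences are spelled with \<open>+ -\<close>
  so that the smoothness rules for sums and negation apply as they stand.\<close>

definition box_bump :: "nat \<Rightarrow> (nat \<Rightarrow> real) \<Rightarrow> real \<Rightarrow> (nat \<Rightarrow> real) \<Rightarrow> real" where
  "box_bump n c r x = (\<Prod>i<n. flat_exp 1 (r + (x i + - c i)) * flat_exp 1 (r + - (x i + - c i)))"

lemma Ck_on_box_bump:
  assumes S: "openin (Euclidean_space n) S"
  shows "Ck_on n k S (box_bump n c r)"
  unfolding box_bump_def
  by (intro Ck_on_prod[OF S] Ck_on_mult[OF S] Ck_on_flat_exp[OF S] Ck_on_add[OF S] Ck_on_const[OF S]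
      Ck_on_uminus[OF S] Ck_on_coord[OF S])

lemma box_bump_pos: "x \<in> coord_box n c r \<Longrightarrow> box_bump n c r x > 0"
  unfolding box_bump_def by (rule prod_pos) (auto simp: coord_box_def flat_exp_def)

lemma box_bump_eq_0: "x \<in> topspace (Euclidean_space n) \<Longrightarrow> x \<notin> coord_box n c r \<Longrightarrow> box_bump n c r x = 0"
proof -
  assume "x \<in> topspace (Euclidean_space n)" "x \<notin> coord_box n c r"
  then obtain i where "i < n" "r \<le> \<bar>x i - c i\<bar>"
    by (auto simp: coord_box_def not_less)
  then have "flat_exp 1 (r + (x i + - c i)) * flat_exp 1 (r + - (x i + - c i)) = 0"
    by (auto simp: flat_exp_def)
  then show ?thesis
    unfolding box_bump_def using \<open>i < n\<close> by (intro prod_zero) auto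
qed

text \<open>A product of closed intervals, and of \<open>{0}\<close> from index \<open>n\<close> on,
  is compact by Tychonoff. This will make supports of bump functions closed in the manifold.\<close>

lemma compact_closed_coord_box:
  "compact {x \<in> topspace (Euclidean_space n). \<forall>i<n. \<bar>x i - c i\<bar> \<le> r}" (is "compact ?K")
proof -
  have "?K = (\<Pi>\<^sub>E i\<in>UNIV. if i < n then cball (c i) r else {0})"
    by (auto simp: topspace_Euclidean_space dist_real_def PiE_iff abs_minus_commute split: if_splits)
  moreover have "compactin (product_topology (\<lambda>i. euclidean) UNIV) (\<Pi>\<^sub>E i\<in>UNIV. if i < n then cball (c i) r else {0})"
    unfolding compactin_PiE by (auto simp: compactin_euclidean_iff)
  ultimately show ?thesis
    by (simp add: euclidean_product_topology compactin_euclidean_iff)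
qed

section \<open>Smooth functions and tangent vectors on manifolds\<close>

context
  fixes n :: nat and U :: "'a::topological_space set" and \<phi> :: "'a \<Rightarrow> nat \<Rightarrow> real"
  assumes chart: "is_chart n (U, \<phi>)"
begin

lemma chart_domain_open: "open U"
  and chart_image_open: "openin (Euclidean_space n) (\<phi> ` U)"
  using chart by (auto simp: is_chart_def)

lemma chart_homeomorphic_map: "homeomorphic_map (top_of_set U) (top_of_set (\<phi> ` U)) \<phi>"
proof -
  have "subtopology (Euclidean_space n) (\<phi> ` U) = top_of_set (\<phi> ` U)"
    using openin_subset[OF chart_image_open]
    by (metis Euclidean_space_eq_top_of_set inf.absorb_iff2 subtopology_subtopology)
  then show ?thesis
    using chart by (simp add: is_chart_def)
qed

lemma chart_inj: "inj_on \<phi> U"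
  using homeomorphic_imp_injective_map[OF chart_homeomorphic_map] by simp

lemma chart_continuous: "continuous_on U \<phi>"
  using homeomorphic_imp_continuous_map[OF chart_homeomorphic_map]
  by (simp add: continuous_map_subtopology_eu)

lemma chart_inv_continuous: "continuous_on (\<phi> ` U) (inv_into U \<phi>)"
proof -
  obtain g where g: "homeomorphic_maps (top_of_set U) (top_of_set (\<phi> ` U)) \<phi> g"
    using chart_homeomorphic_map homeomorphic_map_maps by blast
  then have "continuous_on (\<phi> ` U) g"
    by (simp add: homeomorphic_maps_def continuous_map_subtopology_eu)
  moreover have "g x = inv_into U \<phi> x" if "x \<in> \<phi> ` U" for x
    using g that chart_inj by (auto simp: homeomorphic_maps_def)
  ultimately show ?thesis
    by (simp cong: continuous_on_cong)
qed

lemma chart_open_image: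
  assumes "open W" "W \<subseteq> U"
  shows "openin (Euclidean_space n) (\<phi> ` W)"
proof -
  have "openin (top_of_set U) W"
    using assms by (simp add: open_subset)
  then have "openin (top_of_set (\<phi> ` U)) (\<phi> ` W)"
    using homeomorphic_imp_open_map[OF chart_homeomorphic_map] by (simp add: open_map_def)
  then show ?thesis
    using chart_image_open by (metis Euclidean_space_eq_top_of_set openin_trans)
qed

lemma chart_open_vimage:
  assumes "openin (Euclidean_space n) S"
  shows "open (U \<inter> \<phi> -` S)"
proof -
  obtain X where X: "open X" "S = topspace (Euclidean_space n) \<inter> X"
    using assms openin_Euclidean_space_iff by metis
  have "U \<inter> \<phi> -` S = U \<inter> \<phi> -` X"
    using X openin_subset[OF chart_image_open] by auto
  then show ?thesis
    using continuous_open_preimage[OF chart_continuous chart_domain_open X(1)] by simp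
qed

end

lemma smooth_manifold_chart: "smooth_manifold n A \<Longrightarrow> (U, \<phi>) \<in> A \<Longrightarrow> is_chart n (U, \<phi>)"
  by (auto simp: smooth_manifold_def)

lemma smooth_manifold_cover:
  assumes "smooth_manifold n A"
  obtains U \<phi> where "(U, \<phi>) \<in> A" "p \<in> U"
  using assms unfolding smooth_manifold_def by (metis UNIV_I UN_E prod.collapse)

lemma smooth_functions_Ck:
  "f \<in> smooth_functions n A \<Longrightarrow> (U, \<phi>) \<in> A \<Longrightarrow> Ck_on n k (\<phi> ` U) (f \<circ> inv_into U \<phi>)"
  by (auto simp: smooth_functions_def smooth_fun_on_def)

text \<open>One chart around each point is enough: in any other chart the function is locally a
  composition with a smooth transition map, and the local pieces are glued by
  \<open>Ck_on_local\<close>.\<close>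

lemma smooth_functions_localI:
  assumes M: "smooth_manifold n A"
    and loc: "\<And>p. \<exists>U \<phi> W. (U, \<phi>) \<in> A \<and> open W \<and> p \<in> W \<and> W \<subseteq> U \<and> (\<forall>k. Ck_on n k (\<phi> ` W) (f \<circ> inv_into U \<phi>))"
  shows "f \<in> smooth_functions n A"
proof -
  have "Ck_on n k (\<psi> ` V) (f \<circ> inv_into V \<psi>)" if V: "(V, \<psi>) \<in> A" for V \<psi> k
  proof (rule Ck_on_local)
    note cV = smooth_manifold_chart[OF M V]
    show "openin (Euclidean_space n) (\<psi> ` V)"
      by (rule chart_image_open[OF cV])
    fix y assume "y \<in> \<psi> ` V"
    then obtain p where p: "p \<in> V" "y = \<psi> p" by blast
    obtain U \<phi> W where U: "(U, \<phi>) \<in> A" and W: "open W" "p \<in> W" "W \<subseteq> U"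
      and f: "\<And>k. Ck_on n k (\<phi> ` W) (f \<circ> inv_into U \<phi>)"
      using loc by metis
    note cU = smooth_manifold_chart[OF M U]
    let ?T = "\<psi> ` (V \<inter> W)"
    have T: "openin (Euclidean_space n) ?T"
      by (rule chart_open_image[OF cV]) (use W chart_domain_open[OF cV] in auto)
    have inv: "inv_into V \<psi> (\<psi> q) = q" if "q \<in> V" for q
      by (rule inv_into_f_f[OF chart_inj[OF cV] that])
    have "Ck_on n k ?T (\<lambda>x. (f \<circ> inv_into U \<phi>) ((\<phi> \<circ> inv_into V \<psi>) x))"
    proof (rule Ck_on_compose[OF T chart_open_image[OF cU W(1,3)] _ _ f])
      show "(\<phi> \<circ> inv_into V \<psi>) ` ?T \<subseteq> \<phi> ` W"
        using inv by auto
      fix j assume "j < n"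
      moreover have "smooth_transition n (V, \<psi>) (U, \<phi>)"
        using M U V unfolding smooth_manifold_def by blast
      ultimately have "Ck_on n k (\<psi> ` (V \<inter> U)) (\<lambda>x. (\<phi> \<circ> inv_into V \<psi>) x j)"
        by (simp add: smooth_transition_def smooth_map_on_def smooth_fun_on_def)
      then show "Ck_on n k ?T (\<lambda>x. (\<phi> \<circ> inv_into V \<psi>) x j)"
        by (rule Ck_on_subset) (use W(3) in auto)
    qed
    then have "Ck_on n k ?T (f \<circ> inv_into V \<psi>)"
    proof (rule Ck_on_cong_imp[OF T, rotated])
      fix x assume "x \<in> ?T"
      then obtain q where q: "q \<in> V" "q \<in> U" "x = \<psi> q"
        using W(3) by blast
      then show "(f \<circ> inv_into U \<phi>) ((\<phi> \<circ> inv_into V \<psi>) x) = (f \<circ> inv_into V \<psi>) x"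
        by (simp add: inv inv_into_f_f[OF chart_inj[OF cU]])
    qed
    then show "\<exists>T. openin (Euclidean_space n) T \<and> y \<in> T \<and> T \<subseteq> \<psi> ` V \<and> Ck_on n k T (f \<circ> inv_into V \<psi>)"
      using T p W(2) by (intro exI[of _ ?T]) auto
  qed
  then show ?thesis
    by (auto simp: smooth_functions_def smooth_fun_on_def)
qed

lemma smooth_functions_const:
  assumes "smooth_manifold n A"
  shows "(\<lambda>_. c) \<in> smooth_functions n A"
  using chart_image_open[OF smooth_manifold_chart[OF assms]]
  by (auto simp: smooth_functions_def smooth_fun_on_def o_def Ck_on_const)

lemma smooth_functions_add:
  assumes "smooth_manifold n A" "f \<in> smooth_functions n A" "g \<in> smooth_functions n A"
  shows "(\<lambda>p. f p + g p) \<in> smooth_functions n A"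
  using assms(2,3) Ck_on_add[OF chart_image_open[OF smooth_manifold_chart[OF assms(1)]]]
  by (force simp: smooth_functions_def smooth_fun_on_def o_def)

lemma smooth_functions_mult:
  assumes "smooth_manifold n A" "f \<in> smooth_functions n A" "g \<in> smooth_functions n A"
  shows "(\<lambda>p. f p * g p) \<in> smooth_functions n A"
  using assms(2,3) Ck_on_mult[OF chart_image_open[OF smooth_manifold_chart[OF assms(1)]]]
  by (force simp: smooth_functions_def smooth_fun_on_def o_def)

lemma smooth_functions_cmult:
  assumes "smooth_manifold n A" "f \<in> smooth_functions n A"
  shows "(\<lambda>p. c * f p) \<in> smooth_functions n A"
  by (rule smooth_functions_mult[OF assms(1) smooth_functions_const[OF assms(1)] assms(2)])

lemma smooth_functions_diff:
  assumes "smooth_manifold n A" "f \<in> smooth_functions n A" "g \<in> smooth_functions n A"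
  shows "(\<lambda>p. f p - g p) \<in> smooth_functions n A"
  using smooth_functions_add[OF assms(1,2) smooth_functions_cmult[OF assms(1,3), of "-1"]] by simp

lemma smooth_functions_sum:
  assumes M: "smooth_manifold n A" and "\<And>i. i \<in> I \<Longrightarrow> f i \<in> smooth_functions n A"
  shows "(\<lambda>p. \<Sum>i\<in>I. f i p) \<in> smooth_functions n A"
  using assms(2)
proof (induction I rule: infinite_finite_induct)
  case (insert i I)
  have "(\<lambda>p. f i p + (\<Sum>i\<in>I. f i p)) \<in> smooth_functions n A"
    by (intro smooth_functions_add[OF M] insert.IH insert.prems insertI1 insertI2)
  then show ?case
    using insert.hyps by simp
qed (simp_all add: smooth_functions_const[OF M])

context
  fixes n and A :: "('a::{t2_space, second_countable_topology}) chart set" and p v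
  assumes v: "v \<in> tangent_space n A p"
begin

lemma tangent_add:
  "f \<in> smooth_functions n A \<Longrightarrow> g \<in> smooth_functions n A \<Longrightarrow> v (\<lambda>q. f q + g q) = v f + v g"
  and tangent_cmult: "f \<in> smooth_functions n A \<Longrightarrow> v (\<lambda>q. c * f q) = c * v f"
  and tangent_mult:
  "f \<in> smooth_functions n A \<Longrightarrow> g \<in> smooth_functions n A \<Longrightarrow> v (\<lambda>q. f q * g q) = v f * g p + f p * v g"
  using v by (auto simp: tangent_space_def)

lemma tangent_diff:
  assumes "smooth_manifold n A" "f \<in> smooth_functions n A" "g \<in> smooth_functions n A"
  shows "v (\<lambda>q. f q - g q) = v f - v g"
  using tangent_add[OF assms(2) smooth_functions_cmult[OF assms(1,3), of "-1"]]
    tangent_cmult[OF assms(3), of "-1"] by simp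

lemma tangent_sum:
  assumes M: "smooth_manifold n A" and "\<And>i. i \<in> I \<Longrightarrow> f i \<in> smooth_functions n A"
  shows "v (\<lambda>q. \<Sum>i\<in>I. f i q) = (\<Sum>i\<in>I. v (f i))"
proof -
  \<comment> \<open>Settles the empty index set, and the infinite one, over which sums are
    0.\<close>
  have 0: "v (\<lambda>_. 0) = 0"
    using tangent_cmult[OF smooth_functions_const[OF M], of 0 0] by simp
  show ?thesis
    using assms(2)
  proof (induction I rule: infinite_finite_induct)
    case (insert i I)
    have "v (\<lambda>q. f i q + (\<Sum>i\<in>I. f i q)) = v (f i) + v (\<lambda>q. \<Sum>i\<in>I. f i q)"
      by (intro tangent_add smooth_functions_sum[OF M] insert.prems insertI1 insertI2)
    moreover have "v (\<lambda>q. \<Sum>i\<in>I. f i q) = (\<Sum>i\<in>I. v (f i))"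
      by (intro insert.IH insert.prems insertI2)
    ultimately show ?case
      using insert.hyps by simp
  qed (simp_all add: 0)
qed

end

text \<open>Makes a function of the coordinates into a global function by cutting it off.
  \<open>K = 1\<close> gives the bump itself, and \<open>K\<close> the \<open>i\<close>-th
  coordinate gives a cut-off coordinate function.\<close>

definition bump_extension ::
    "nat \<Rightarrow> 'a chart \<Rightarrow> (nat \<Rightarrow> real) \<Rightarrow> real \<Rightarrow> ((nat \<Rightarrow> real) \<Rightarrow> real) \<Rightarrow> 'a \<Rightarrow> real" where
  "bump_extension n C c s K p = (if p \<in> fst C then box_bump n c s (snd C p) * K (snd C p) else 0)"

text \<open>The manifold is covered by the part of the chart over the larger box, where the
  extension is a product of smooth functions, and the complement of \<open>L\<close>, where it is 0.
  The margin \<open>s < r\<close> keeps the closed box of radius \<open>s\<close> inside the domain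
  of \<open>K\<close>.\<close>

lemma bump_extension_smooth:
  fixes A :: "('a::{t2_space, second_countable_topology}) chart set"
  assumes M: "smooth_manifold n A" and U: "(U, \<phi>) \<in> A"
    and B: "coord_box n c r \<subseteq> \<phi> ` U" and s: "s < r"
    and K: "\<And>k. Ck_on n k (coord_box n c r) K"
  shows "bump_extension n (U, \<phi>) c s K \<in> smooth_functions n A"
proof (rule smooth_functions_localI[OF M])
  fix p
  let ?f = "bump_extension n (U, \<phi>) c s K"
  let ?K = "{x \<in> topspace (Euclidean_space n). \<forall>i<n. \<bar>x i - c i\<bar> \<le> s}"
  define L where "L = inv_into U \<phi> ` ?K"
  note cU = smooth_manifold_chart[OF M U]
  have Kr: "?K \<subseteq> coord_box n c r"
    using s by (force simp: coord_box_def)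
  have "compact L"
    unfolding L_def
    by (rule compact_continuous_image[OF continuous_on_subset[OF chart_inv_continuous[OF cU]] compact_closed_coord_box])
      (use Kr B in blast)
  \<comment> \<open>Here the Hausdorff property is used; it makes the complement of \<open>L\<close>
    open in the whole manifold, not merely in \<open>U\<close>.\<close>
  then have "closed L"
    by (rule compact_imp_closed)
  show "\<exists>U \<phi> W. (U, \<phi>) \<in> A \<and> open W \<and> p \<in> W \<and> W \<subseteq> U \<and> (\<forall>k. Ck_on n k (\<phi> ` W) (?f \<circ> inv_into U \<phi>))"
  proof (cases "p \<in> L")
    case True
    define W where "W = U \<inter> \<phi> -` coord_box n c r"
    have "open W"
      unfolding W_def by (rule chart_open_vimage[OF cU openin_coord_box])
    have \<phi>W: "\<phi> ` W = coord_box n c r"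
      using B by (auto simp: W_def)
    have "p \<in> W"
      using True Kr B by (auto simp: L_def W_def f_inv_into_f inv_into_into subset_iff)
    moreover have "Ck_on n k (\<phi> ` W) (?f \<circ> inv_into U \<phi>)" for k
      unfolding \<phi>W
    proof (rule Ck_on_cong_imp[OF openin_coord_box _ Ck_on_mult[OF openin_coord_box Ck_on_box_bump[OF openin_coord_box] K]])
      fix x assume "x \<in> coord_box n c r"
      then have "x \<in> \<phi> ` U" using B by blast
      then show "box_bump n c s x * K x = (?f \<circ> inv_into U \<phi>) x"
        by (simp add: bump_extension_def inv_into_into f_inv_into_f)
    qed
    ultimately show ?thesis
      using U \<open>open W\<close> by (intro exI[of _ U] exI[of _ \<phi>] exI[of _ W]) (auto simp: W_def)
  next
    case False
    obtain V \<psi> where V: "(V, \<psi>) \<in> A" "p \<in> V"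
      using smooth_manifold_cover[OF M] by metis
    note cV = smooth_manifold_chart[OF M V(1)]
    have W: "open (V - L)"
      using chart_domain_open[OF cV] \<open>closed L\<close> by blast
    have "?f q = 0" if "q \<notin> L" for q
    proof (cases "q \<in> U")
      case True
      have "\<phi> q \<notin> ?K"
        using that True inv_into_f_f[OF chart_inj[OF cU] True] by (force simp: L_def)
      then have "\<phi> q \<notin> coord_box n c s"
        by (auto simp: coord_box_def)
      moreover have "\<phi> q \<in> topspace (Euclidean_space n)"
        using True openin_subset[OF chart_image_open[OF cU]] by blast
      ultimately show ?thesis
        by (simp add: bump_extension_def box_bump_eq_0)
    qed (simp add: bump_extension_def)
    then have "(?f \<circ> inv_into V \<psi>) x = 0" if "x \<in> \<psi> ` (V - L)" for x
      using that inv_into_f_f[OF chart_inj[OF cV]] by auto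
    then have "Ck_on n k (\<psi> ` (V - L)) (?f \<circ> inv_into V \<psi>)" for k
      by (intro Ck_on_cong_imp[OF chart_open_image[OF cV W] _ Ck_on_const[OF chart_open_image[OF cV W], of k 0]]) auto
    then show ?thesis
      using V False W by (intro exI[of _ V] exI[of _ \<psi>] exI[of _ "V - L"]) auto
  qed
qed

text \<open>Multiplying by the square of the bump function turns Hadamard's formula around \<open>\<phi> p\<close> into an
  identity between global smooth functions, to which the derivation applies.\<close>

lemma tangent_vector_in_chart:
  fixes A :: "('a::{t2_space, second_countable_topology}) chart set"
  assumes M: "smooth_manifold n A" and U: "(U, \<phi>) \<in> A"
    and B: "coord_box n c r \<subseteq> \<phi> ` U" and s: "s < r"
    and p: "p \<in> U" "\<phi> p \<in> coord_box n c s"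
    and v: "v \<in> tangent_space n A p" and h: "h \<in> smooth_functions n A"
  shows "box_bump n c s (\<phi> p) * v h =
    (\<Sum>i<n. (v (bump_extension n (U, \<phi>) c s (\<lambda>x. x i)) - \<phi> p i * v (bump_extension n (U, \<phi>) c s (\<lambda>_. 1)))
      * partial_derivative i (h \<circ> inv_into U \<phi>) (\<phi> p))"
proof -
  define E where "E = bump_extension n (U, \<phi>) c s"
  define x where "x = \<phi> p"
  define \<beta> where "\<beta> = E (\<lambda>_. 1)"
  define Y where "Y = (\<lambda>i. E (\<lambda>x. x i))"
  define k where "k = hadamard_coeff (h \<circ> inv_into U \<phi>) x"
  note cU = smooth_manifold_chart[OF M U]
  have inv: "inv_into U \<phi> (\<phi> q) = q" if "q \<in> U" for q
    by (rule inv_into_f_f[OF chart_inj[OF cU] that])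
  have xr: "x \<in> coord_box n c r"
    using p(2) s by (force simp: coord_box_def x_def)
  have hr: "Ck_on n j (coord_box n c r) (h \<circ> inv_into U \<phi>)" for j
    by (rule Ck_on_subset[OF smooth_functions_Ck[OF h U] B])
  have Esm: "E K \<in> smooth_functions n A" if "\<And>j. Ck_on n j (coord_box n c r) K" for K
    unfolding E_def by (rule bump_extension_smooth[OF M U B s that])
  have \<beta>: "\<beta> \<in> smooth_functions n A"
    unfolding \<beta>_def by (intro Esm Ck_on_const openin_coord_box)
  have Y: "Y i \<in> smooth_functions n A" for i
    unfolding Y_def by (intro Esm Ck_on_coord openin_coord_box)
  have k: "E (k i) \<in> smooth_functions n A" if "i < n" for i
    unfolding k_def by (intro Esm Ck_on_hadamard_coeff[OF xr hr that])
  have Ep: "E K p = box_bump n c s x * K x" for K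
    using p by (simp add: E_def bump_extension_def x_def)
  \<comment> \<open>One factor \<open>\<beta>\<close> makes the linear term global, the other the
    Hadamard coefficient. Outside the smaller box both sides are 0.\<close>
  have eq: "(\<beta> q * \<beta> q) * h q = h p * (\<beta> q * \<beta> q) + (\<Sum>i<n. (Y i q - x i * \<beta> q) * E (k i) q)" for q
  proof (cases "q \<in> U \<and> \<phi> q \<in> coord_box n c s")
    case True
    then have "\<phi> q \<in> coord_box n c r"
      using s by (force simp: coord_box_def)
    from hadamard[OF xr hr this] have "h q = h p + (\<Sum>i<n. (\<phi> q i - x i) * k i (\<phi> q))"
      using True p by (simp add: inv k_def x_def)
    then have "(\<beta> q * \<beta> q) * h q = h p * (\<beta> q * \<beta> q) + (\<Sum>i<n. (\<beta> q * \<beta> q) * ((\<phi> q i - x i) * k i (\<phi> q)))"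
      by (simp add: sum_distrib_left algebra_simps)
    also have "(\<Sum>i<n. (\<beta> q * \<beta> q) * ((\<phi> q i - x i) * k i (\<phi> q))) = (\<Sum>i<n. (Y i q - x i * \<beta> q) * E (k i) q)"
      using True by (intro sum.cong) (auto simp: \<beta>_def Y_def E_def bump_extension_def algebra_simps)
    finally show ?thesis .
  next
    case False
    have "E K q = 0" for K
    proof (cases "q \<in> U")
      case True
      then have "\<phi> q \<in> topspace (Euclidean_space n)"
        using openin_subset[OF chart_image_open[OF cU]] by blast
      then show ?thesis
        using True False by (simp add: E_def bump_extension_def box_bump_eq_0)
    qed (simp add: E_def bump_extension_def)
    then show ?thesis
      by (simp add: \<beta>_def)
  qed
  let ?b = "box_bump n c s x"
  have \<beta>2: "(\<lambda>q. \<beta> q * \<beta> q) \<in> smooth_functions n A"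
    by (rule smooth_functions_mult[OF M \<beta> \<beta>])
  have Y\<beta>: "(\<lambda>q. Y i q - x i * \<beta> q) \<in> smooth_functions n A" for i
    by (intro smooth_functions_diff[OF M] smooth_functions_cmult[OF M] Y \<beta>)
  have "v (\<lambda>q. (\<beta> q * \<beta> q) * h q) = v (\<lambda>q. \<beta> q * \<beta> q) * h p + (?b * ?b) * v h"
    by (subst tangent_mult[OF v \<beta>2 h]) (simp add: \<beta>_def Ep)
  moreover have "v (\<lambda>q. (\<beta> q * \<beta> q) * h q)
      = h p * v (\<lambda>q. \<beta> q * \<beta> q) + (\<Sum>i<n. v (\<lambda>q. (Y i q - x i * \<beta> q) * E (k i) q))"
  proof -
    have Yk: "(\<lambda>q. (Y i q - x i * \<beta> q) * E (k i) q) \<in> smooth_functions n A" if "i \<in> {..<n}" for i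
      using that by (intro smooth_functions_mult[OF M] Y\<beta> k) simp
    have "v (\<lambda>q. h p * (\<beta> q * \<beta> q) + (\<Sum>i<n. (Y i q - x i * \<beta> q) * E (k i) q))
        = v (\<lambda>q. h p * (\<beta> q * \<beta> q)) + v (\<lambda>q. \<Sum>i<n. (Y i q - x i * \<beta> q) * E (k i) q)"
      by (rule tangent_add[OF v smooth_functions_cmult[OF M \<beta>2] smooth_functions_sum[OF M]]) (rule Yk)
    also have "v (\<lambda>q. \<Sum>i<n. (Y i q - x i * \<beta> q) * E (k i) q) = (\<Sum>i<n. v (\<lambda>q. (Y i q - x i * \<beta> q) * E (k i) q))"
      by (rule tangent_sum[OF v M]) (rule Yk)
    finally show ?thesis
      unfolding eq tangent_cmult[OF v \<beta>2] .
  qed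
  moreover have "v (\<lambda>q. (Y i q - x i * \<beta> q) * E (k i) q)
      = ?b * ((v (Y i) - x i * v \<beta>) * partial_derivative i (h \<circ> inv_into U \<phi>) x)" if "i < n" for i
  proof -
    have "v (\<lambda>q. (Y i q - x i * \<beta> q) * E (k i) q)
        = v (\<lambda>q. Y i q - x i * \<beta> q) * E (k i) p + (Y i p - x i * \<beta> p) * v (E (k i))"
      by (rule tangent_mult[OF v Y\<beta> k[OF that]])
    \<comment> \<open>The linear factor vanishes at \<open>p\<close>, so the Leibniz term with the
      unknown derivative of the Hadamard coefficient drops out.\<close>
    also have "Y i p - x i * \<beta> p = 0"
      by (simp add: Y_def \<beta>_def Ep)
    also have "v (\<lambda>q. Y i q - x i * \<beta> q) = v (Y i) - x i * v \<beta>"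
      by (simp add: tangent_diff[OF v M Y smooth_functions_cmult[OF M \<beta>]] tangent_cmult[OF v \<beta>])
    also have "E (k i) p = ?b * partial_derivative i (h \<circ> inv_into U \<phi>) x"
      by (simp add: Ep k_def hadamard_coeff_same)
    finally show ?thesis by simp
  qed
  \<comment> \<open>The terms \<open>h p * v (\<lambda>q. \<beta> q * \<beta> q)\<close> on both
    sides cancel; afterwards one positive factor \<open>?b\<close> is divided out.\<close>
  ultimately have "?b * (?b * v h) = ?b * (\<Sum>i<n. (v (Y i) - x i * v \<beta>) * partial_derivative i (h \<circ> inv_into U \<phi>) x)"
    by (simp add: sum_distrib_left mult.assoc)
  moreover have "?b > 0"
    using box_bump_pos p(2) by (simp add: x_def)
  ultimately show ?thesis
    by (simp add: x_def Y_def \<beta>_def E_def)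
qed

section \<open>Products of manifolds\<close>

definition coord_append :: "nat \<Rightarrow> (nat \<Rightarrow> real) \<Rightarrow> (nat \<Rightarrow> real) \<Rightarrow> nat \<Rightarrow> real" where
  "coord_append m x y = (\<lambda>i. if i < m then x i else y (i - m))"

lemma product_chart_eq:
  "product_chart m (U, \<phi>) (V, \<psi>) = (U \<times> V, \<lambda>(p, q). coord_append m (\<phi> p) (\<psi> q))"
  by (auto simp: product_chart_def coord_append_def fun_eq_iff)

lemma coord_append_fun_upd: "coord_append m x (y(k := t)) = (coord_append m x y)(m + k := t)"
  by (auto simp: coord_append_def fun_eq_iff)

lemma coord_append_in_Euclidean_space:
  "y \<in> topspace (Euclidean_space n) \<Longrightarrow> coord_append m x y \<in> topspace (Euclidean_space (m + n))"
  by (auto simp: topspace_Euclidean_space coord_append_def)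

lemma coord_append_inject:
  assumes "x \<in> topspace (Euclidean_space m)" "x' \<in> topspace (Euclidean_space m)"
    and "coord_append m x y = coord_append m x' y'"
  shows "x = x' \<and> y = y'"
proof
  show "x = x'"
  proof
    fix i
    show "x i = x' i"
      using fun_cong[OF assms(3), of i] assms(1,2)
      by (cases "i < m") (auto simp: coord_append_def topspace_Euclidean_space)
  qed
  show "y = y'"
  proof
    fix i
    show "y i = y' i"
      using fun_cong[OF assms(3), of "m + i"] by (simp add: coord_append_def)
  qed
qed

lemma Ck_on_coord_append:
  assumes S: "openin (Euclidean_space l) S"
    and "\<And>j. j < m \<Longrightarrow> Ck_on l k S (\<lambda>x. F x j)" "\<And>j. j < n \<Longrightarrow> Ck_on l k S (\<lambda>x. G x j)" "j < m + n"
  shows "Ck_on l k S (\<lambda>x. coord_append m (F x) (G x) j)"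
  using assms(2)[of j] assms(3)[of "j - m"] assms(4) by (cases "j < m") (auto simp: coord_append_def)

lemma openin_coord_append_image:
  assumes X: "openin (Euclidean_space m) X" and Y: "openin (Euclidean_space n) Y"
  shows "openin (Euclidean_space (m + n)) ((\<lambda>(x, y). coord_append m x y) ` (X \<times> Y))"
proof -
  obtain X' Y' where X': "open X'" "X = topspace (Euclidean_space m) \<inter> X'"
    and Y': "open Y'" "Y = topspace (Euclidean_space n) \<inter> Y'"
    using X Y openin_Euclidean_space_iff by metis
  \<comment> \<open>\<open>L\<close> and \<open>R\<close> recover the two blocks of coordinates.
    They are continuous on the whole function space, so the image is the trace of an open
    set.\<close>
  define L where "L = (\<lambda>(z :: nat \<Rightarrow> real) i. if i < m then z i else 0)"
  define R where "R = (\<lambda>(z :: nat \<Rightarrow> real) i. z (m + i))"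
  have "continuous_on UNIV L"
    unfolding L_def
  proof (rule continuous_on_coordinatewise_then_product)
    show "continuous_on UNIV (\<lambda>z::nat \<Rightarrow> real. if i < m then z i else 0)" for i
      by (cases "i < m") (auto intro: continuous_on_coord)
  qed
  moreover have "continuous_on UNIV R"
    unfolding R_def by (rule continuous_on_coordinatewise_then_product) (rule continuous_on_coord)
  ultimately have "open (L -` X' \<inter> R -` Y')"
    using X'(1) Y'(1) by (intro open_Int open_vimage)
  moreover have "(\<lambda>(x, y). coord_append m x y) ` (X \<times> Y) = topspace (Euclidean_space (m + n)) \<inter> (L -` X' \<inter> R -` Y')"
  proof (intro equalityI subsetI)
    fix z assume "z \<in> (\<lambda>(x, y). coord_append m x y) ` (X \<times> Y)"
    then obtain x y where xy: "x \<in> X" "y \<in> Y" "z = coord_append m x y" by auto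
    then have "L z = x" "R z = y"
      using X'(2) by (auto simp: L_def R_def coord_append_def topspace_Euclidean_space fun_eq_iff)
    then show "z \<in> topspace (Euclidean_space (m + n)) \<inter> (L -` X' \<inter> R -` Y')"
      using xy X' Y' by (auto intro: coord_append_in_Euclidean_space)
  next
    fix z assume z: "z \<in> topspace (Euclidean_space (m + n)) \<inter> (L -` X' \<inter> R -` Y')"
    then have "z = coord_append m (L z) (R z)" "L z \<in> X" "R z \<in> Y"
      using X' Y' by (auto simp: L_def R_def coord_append_def topspace_Euclidean_space fun_eq_iff)
    then show "z \<in> (\<lambda>(x, y). coord_append m x y) ` (X \<times> Y)"
      by force
  qed
  ultimately show ?thesis
    unfolding openin_Euclidean_space_iff by blast
qed

lemma openin_product_chart_image:
  assumes cU: "is_chart m (U, \<phi>)" and cV: "is_chart n (V, \<psi>)"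
    and O: "open O1" "O1 \<subseteq> U" "open O2" "O2 \<subseteq> V"
  shows "openin (Euclidean_space (m + n)) ((\<lambda>(p, q). coord_append m (\<phi> p) (\<psi> q)) ` (O1 \<times> O2))"
proof -
  have "(\<lambda>(p, q). coord_append m (\<phi> p) (\<psi> q)) ` (O1 \<times> O2)
      = (\<lambda>(x, y). coord_append m x y) ` (\<phi> ` O1 \<times> \<psi> ` O2)"
    by force
  then show ?thesis
    using openin_coord_append_image[OF chart_open_image[OF cU O(1,2)] chart_open_image[OF cV O(3,4)]] by simp
qed

lemma inv_into_product_chart:
  assumes cU: "is_chart m (U, \<phi>)" and cV: "is_chart n (V, \<psi>)" and "p \<in> U" "q \<in> V"
  shows "inv_into (U \<times> V) (\<lambda>(p, q). coord_append m (\<phi> p) (\<psi> q)) (coord_append m (\<phi> p) (\<psi> q)) = (p, q)"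
proof -
  have "inj_on (\<lambda>(p, q). coord_append m (\<phi> p) (\<psi> q)) (U \<times> V)"
  proof (rule inj_onI; clarify)
    fix p q p' q' assume *: "p \<in> U" "q \<in> V" "p' \<in> U" "q' \<in> V"
      "coord_append m (\<phi> p) (\<psi> q) = coord_append m (\<phi> p') (\<psi> q')"
    then have "\<phi> p = \<phi> p' \<and> \<psi> q = \<psi> q'"
      using openin_subset[OF chart_image_open[OF cU]] by (intro coord_append_inject) auto
    then show "p = p' \<and> q = q'"
      using * chart_inj[OF cU] chart_inj[OF cV] by (auto dest: inj_onD)
  qed
  from inv_into_f_f[OF this, of "(p, q)"] assms(3,4) show ?thesis by simp
qed

lemma product_atlasI: "c \<in> A \<Longrightarrow> d \<in> B \<Longrightarrow> product_chart m c d \<in> product_atlas m A B"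
  unfolding product_atlas_def by blast

lemma product_smooth_Ck:
  assumes "H \<in> smooth_functions (m + n) (product_atlas m B A)" "(U, \<phi>) \<in> B" "(V, \<psi>) \<in> A"
  shows "Ck_on (m + n) k ((\<lambda>(p, q). coord_append m (\<phi> p) (\<psi> q)) ` (U \<times> V))
    (H \<circ> inv_into (U \<times> V) (\<lambda>(p, q). coord_append m (\<phi> p) (\<psi> q)))"
  using smooth_functions_Ck[OF assms(1) product_atlasI[OF assms(2,3), of m, unfolded product_chart_eq]] .

text \<open>In coordinates the slice is a composition with the map that prepends the constant block
  \<open>\<phi> p\<close>, whose components are constants and coordinates.\<close>

lemma smooth_function_slice:
  fixes A :: "('a::{t2_space, second_countable_topology}) chart set"
    and B :: "('b::{t2_space, second_countable_topology}) chart set"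
  assumes MB: "smooth_manifold m B" and MA: "smooth_manifold n A"
    and H: "H \<in> smooth_functions (m + n) (product_atlas m B A)"
  shows "(\<lambda>q. H (p, q)) \<in> smooth_functions n A"
proof -
  obtain U \<phi> where U: "(U, \<phi>) \<in> B" "p \<in> U"
    using smooth_manifold_cover[OF MB] by metis
  note cU = smooth_manifold_chart[OF MB U(1)]
  have "Ck_on n k (\<psi> ` V) ((\<lambda>q. H (p, q)) \<circ> inv_into V \<psi>)" if V: "(V, \<psi>) \<in> A" for V \<psi> k
  proof -
    note cV = smooth_manifold_chart[OF MA V]
    let ?\<rho> = "\<lambda>(p, q). coord_append m (\<phi> p) (\<psi> q)"
    have "Ck_on n k (\<psi> ` V) (\<lambda>y. (H \<circ> inv_into (U \<times> V) ?\<rho>) (coord_append m (\<phi> p) y))"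
    proof (rule Ck_on_compose[OF chart_image_open[OF cV]
          openin_product_chart_image[OF cU cV chart_domain_open[OF cU] order_refl chart_domain_open[OF cV] order_refl]
          _ _ product_smooth_Ck[OF H U(1) V]])
      show "coord_append m (\<phi> p) ` \<psi> ` V \<subseteq> ?\<rho> ` (U \<times> V)"
        using U(2) by force
      show "Ck_on n k (\<psi> ` V) (\<lambda>y. coord_append m (\<phi> p) y j)" if "j < m + n" for j
        by (rule Ck_on_coord_append[OF chart_image_open[OF cV] _ _ that])
          (intro Ck_on_const Ck_on_coord chart_image_open[OF cV])+
    qed
    then show ?thesis
    proof (rule Ck_on_cong_imp[OF chart_image_open[OF cV], rotated])
      fix y assume "y \<in> \<psi> ` V"
      then obtain q where "q \<in> V" "y = \<psi> q" by blast
      then show "(H \<circ> inv_into (U \<times> V) ?\<rho>) (coord_append m (\<phi> p) y) = ((\<lambda>q. H (p, q)) \<circ> inv_into V \<psi>) y"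
        by (simp add: inv_into_product_chart[OF cU cV U(2)] inv_into_f_f[OF chart_inj[OF cV]])
    qed
  qed
  then show ?thesis
    by (auto simp: smooth_functions_def smooth_fun_on_def)
qed

lemma smooth_map_Ck:
  "smooth_map n A m B F \<Longrightarrow> (U, \<phi>) \<in> A \<Longrightarrow> (V, \<psi>) \<in> B \<Longrightarrow> j < m \<Longrightarrow>
    Ck_on n k (\<phi> ` (U \<inter> F -` V)) (\<lambda>x. \<psi> (F (inv_into U \<phi> x)) j)"
  by (fastforce simp: smooth_map_def smooth_map_on_def smooth_fun_on_def)

text \<open>Will be applied to the group multiplication. Near each point the composition factors
  through a single target chart, where \<open>Ck_on_compose\<close> applies.\<close>

lemma smooth_functions_compose_product:
  fixes A :: "('a::{t2_space, second_countable_topology}) chart set"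
    and B :: "('b::{t2_space, second_countable_topology}) chart set"
    and C :: "('c::{t2_space, second_countable_topology}) chart set"
  assumes MB: "smooth_manifold m B" and MA: "smooth_manifold n A" and MC: "smooth_manifold l C"
    and F: "smooth_map (m + n) (product_atlas m B A) l C F" and f: "f \<in> smooth_functions l C"
  shows "f \<circ> F \<in> smooth_functions (m + n) (product_atlas m B A)"
proof -
  have "Ck_on (m + n) k (\<rho> ` P) ((f \<circ> F) \<circ> inv_into P \<rho>)"
    if P: "(P, \<rho>) \<in> product_atlas m B A" for P \<rho> k
  proof -
    obtain U \<phi> V \<psi> where U: "(U, \<phi>) \<in> B" and V: "(V, \<psi>) \<in> A"
      and "(P, \<rho>) = product_chart m (U, \<phi>) (V, \<psi>)"
      using P by (auto simp: product_atlas_def)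
    then have P_eq: "P = U \<times> V" and \<rho>_eq: "\<rho> = (\<lambda>(p, q). coord_append m (\<phi> p) (\<psi> q))"
      by (simp_all add: product_chart_eq)
    note cU = smooth_manifold_chart[OF MB U] and cV = smooth_manifold_chart[OF MA V]
    have inv: "inv_into P \<rho> (\<rho> z) = z" if "z \<in> P" for z
      using that inv_into_product_chart[OF cU cV] by (auto simp: P_eq \<rho>_eq)
    show ?thesis
    proof (rule Ck_on_local)
      show "openin (Euclidean_space (m + n)) (\<rho> ` P)"
        unfolding P_eq \<rho>_eq
        by (intro openin_product_chart_image[OF cU cV] chart_domain_open[OF cU] chart_domain_open[OF cV] order_refl)
      fix z assume "z \<in> \<rho> ` P"
      then obtain p q where pq: "p \<in> U" "q \<in> V" "z = \<rho> (p, q)"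
        by (auto simp: P_eq)
      obtain W \<omega> where W: "(W, \<omega>) \<in> C" "F (p, q) \<in> W"
        using smooth_manifold_cover[OF MC] by metis
      note cW = smooth_manifold_chart[OF MC W(1)]
      have "open (F -` W)"
        using F chart_domain_open[OF cW] by (auto simp: smooth_map_def intro: open_vimage)
      then have "open (U \<times> V \<inter> F -` W)"
        using chart_domain_open[OF cU] chart_domain_open[OF cV] by (intro open_Int open_Times)
      moreover have "(p, q) \<in> U \<times> V \<inter> F -` W"
        using pq W by simp
      \<comment> \<open>Passing to an open rectangle gives a set whose image under the product chart
        is known to be open.\<close>
      ultimately obtain O1 O2 where O: "open O1" "open O2" "(p, q) \<in> O1 \<times> O2" "O1 \<times> O2 \<subseteq> U \<times> V \<inter> F -` W"
        by (rule open_prod_elim)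
      then have O': "O1 \<subseteq> U" "O2 \<subseteq> V"
        by blast+
      have T: "openin (Euclidean_space (m + n)) (\<rho> ` (O1 \<times> O2))"
        unfolding \<rho>_eq by (rule openin_product_chart_image[OF cU cV O(1) O'(1) O(2) O'(2)])
      have "Ck_on (m + n) k (\<rho> ` (O1 \<times> O2)) (\<lambda>x. (f \<circ> inv_into W \<omega>) (\<omega> (F (inv_into P \<rho> x))))"
      proof (rule Ck_on_compose[OF T chart_image_open[OF cW] _ _ smooth_functions_Ck[OF f W(1)]])
        show "(\<lambda>x. \<omega> (F (inv_into P \<rho> x))) ` \<rho> ` (O1 \<times> O2) \<subseteq> \<omega> ` W"
        proof clarify
          fix a b assume "a \<in> O1" "b \<in> O2"
          then have "(a, b) \<in> U \<times> V \<inter> F -` W"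
            using O(4) by blast
          then show "\<omega> (F (inv_into P \<rho> (\<rho> (a, b)))) \<in> \<omega> ` W"
            using inv[of "(a, b)"] by (simp add: P_eq)
        qed
        fix j assume "j < l"
        from smooth_map_Ck[OF F P W(1) this]
        have "Ck_on (m + n) k (\<rho> ` (P \<inter> F -` W)) (\<lambda>x. \<omega> (F (inv_into P \<rho> x)) j)" .
        then show "Ck_on (m + n) k (\<rho> ` (O1 \<times> O2)) (\<lambda>x. \<omega> (F (inv_into P \<rho> x)) j)"
          by (rule Ck_on_subset) (use O(4) P_eq in blast)
      qed
      then have "Ck_on (m + n) k (\<rho> ` (O1 \<times> O2)) ((f \<circ> F) \<circ> inv_into P \<rho>)"
      proof (rule Ck_on_cong_imp[OF T, rotated])
        fix x assume "x \<in> \<rho> ` (O1 \<times> O2)"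
        then obtain w where w: "w \<in> O1 \<times> O2" "x = \<rho> w" by blast
        then have "w \<in> P" "F w \<in> W"
          using O(4) P_eq by blast+
        then show "(f \<circ> inv_into W \<omega>) (\<omega> (F (inv_into P \<rho> x))) = ((f \<circ> F) \<circ> inv_into P \<rho>) x"
          by (simp add: w(2) inv inv_into_f_f[OF chart_inj[OF cW]])
      qed
      moreover have "\<rho> ` (O1 \<times> O2) \<subseteq> \<rho> ` P"
        using O' P_eq by blast
      moreover have "z \<in> \<rho> ` (O1 \<times> O2)"
        using O(3) pq(3) by blast
      ultimately show "\<exists>T. openin (Euclidean_space (m + n)) T \<and> z \<in> T \<and> T \<subseteq> \<rho> ` P \<and>
          Ck_on (m + n) k T ((f \<circ> F) \<circ> inv_into P \<rho>)"
        using T by blast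
    qed
  qed
  then show ?thesis
    by (auto simp: smooth_functions_def smooth_fun_on_def)
qed

lemma smooth_map_id:
  fixes A :: "('a::{t2_space, second_countable_topology}) chart set"
  assumes M: "smooth_manifold n A"
  shows "smooth_map n A n A (\<lambda>p. p)"
  using M unfolding smooth_manifold_def smooth_map_def smooth_transition_def
  by (fastforce simp: o_def)

lemma smooth_map_const:
  fixes A :: "('a::{t2_space, second_countable_topology}) chart set"
  assumes M: "smooth_manifold n A"
  shows "smooth_map n A m B (\<lambda>p. b)"
proof -
  have "Ck_on n k (\<phi> ` (U \<inter> (\<lambda>p. b) -` V)) (\<lambda>x. c)" if "(U, \<phi>) \<in> A" for U \<phi> V k and c :: real
    by (rule Ck_on_subset[OF Ck_on_const[OF chart_image_open[OF smooth_manifold_chart[OF M that]]]]) blast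
  then show ?thesis
    by (auto simp: smooth_map_def smooth_map_on_def smooth_fun_on_def o_def)
qed

text \<open>In coordinates \<open>v\<^sub>p\<close> is a combination of the coordinate derivatives at \<open>\<sigma> p\<close> with smooth
  coefficients, so that the left-hand side is a smooth combination of partial derivatives of \<open>H\<close>.\<close>

lemma smooth_partial_tangent:
  fixes A :: "('a::{t2_space, second_countable_topology}) chart set"
    and B :: "('b::{t2_space, second_countable_topology}) chart set"
    and C :: "('c::{t2_space, second_countable_topology}) chart set"
  assumes MB: "smooth_manifold m B" and MA: "smooth_manifold n A" and MC: "smooth_manifold l C"
    and \<tau>: "smooth_map l C m B \<tau>" and \<sigma>: "smooth_map l C n A \<sigma>"
    and v: "\<And>p. v p \<in> tangent_space n A (\<sigma> p)"
    and vs: "\<And>h. h \<in> smooth_functions n A \<Longrightarrow> (\<lambda>p. v p h) \<in> smooth_functions l C"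
    and H: "H \<in> smooth_functions (m + n) (product_atlas m B A)"
  shows "(\<lambda>p. v p (\<lambda>q. H (\<tau> p, q))) \<in> smooth_functions l C"
proof (rule smooth_functions_localI[OF MC])
  fix p0
  obtain Z \<zeta> where Z: "(Z, \<zeta>) \<in> C" "p0 \<in> Z" using smooth_manifold_cover[OF MC] by metis
  obtain U \<phi> where U: "(U, \<phi>) \<in> B" "\<tau> p0 \<in> U" using smooth_manifold_cover[OF MB] by metis
  obtain V \<psi> where V: "(V, \<psi>) \<in> A" "\<sigma> p0 \<in> V" using smooth_manifold_cover[OF MA] by metis
  note cZ = smooth_manifold_chart[OF MC Z(1)] and cU = smooth_manifold_chart[OF MB U(1)]
    and cV = smooth_manifold_chart[OF MA V(1)]
  define c where "c = \<psi> (\<sigma> p0)"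
  have "c \<in> \<psi> ` V" using V(2) by (simp add: c_def)
  then obtain r where r: "r > 0" "coord_box n c r \<subseteq> \<psi> ` V"
    using openin_contains_coord_box[OF chart_image_open[OF cV]] by metis
  \<comment> \<open>Half the radius leaves the margin needed for smooth extension. On
    \<open>W\<close> the point \<open>\<sigma> p\<close> stays in the box of radius
    \<open>s\<close>, where the bump is positive and can be inverted.\<close>
  define s where "s = r / 2"
  have s: "s < r" "s > 0" using r(1) by (simp_all add: s_def)
  define W where "W = Z \<inter> \<tau> -` U \<inter> \<sigma> -` (V \<inter> \<psi> -` coord_box n c s)"
  have W: "open W"
    unfolding W_def using \<tau> \<sigma>
    by (intro open_Int open_vimage chart_domain_open[OF cZ] chart_domain_open[OF cU]
        chart_open_vimage[OF cV openin_coord_box]) (simp_all add: smooth_map_def)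
  have WZ: "W \<subseteq> Z" by (auto simp: W_def)
  have p0W: "p0 \<in> W"
    using Z U V s openin_subset[OF chart_image_open[OF cV]]
    by (auto simp: W_def coord_box_def c_def)
  have T: "openin (Euclidean_space l) (\<zeta> ` W)"
    by (rule chart_open_image[OF cZ W WZ])
  have inv: "inv_into Z \<zeta> (\<zeta> p) = p" if "p \<in> W" for p
    by (rule inv_into_f_f[OF chart_inj[OF cZ]]) (use that WZ in blast)
  let ?\<rho> = "\<lambda>(p, q). coord_append m (\<phi> p) (\<psi> q)"
  define K where "K = H \<circ> inv_into (U \<times> V) ?\<rho>"
  define \<beta> where "\<beta> = bump_extension n (V, \<psi>) c s (\<lambda>_. 1)"
  define Y where "Y = (\<lambda>i. bump_extension n (V, \<psi>) c s (\<lambda>x. x i))"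
  have \<beta>: "\<beta> \<in> smooth_functions n A" and Y: "Y i \<in> smooth_functions n A" for i
    unfolding \<beta>_def Y_def
    by (intro bump_extension_smooth[OF MA V(1) r(2) s(1)] Ck_on_const Ck_on_coord openin_coord_box)+
  \<comment> \<open>The \<open>i\<close>-th term of the coordinate formula for a tangent vector,
    with the bump factor divided out.\<close>
  define \<alpha> where "\<alpha> = (\<lambda>p i. inverse (box_bump n c s (\<psi> (\<sigma> p))) * ((v p (Y i) + - (\<psi> (\<sigma> p) i * v p \<beta>))
      * partial_derivative (m + i) K (coord_append m (\<phi> (\<tau> p)) (\<psi> (\<sigma> p)))))"
  have eq: "v p (\<lambda>q. H (\<tau> p, q)) = (\<Sum>i<n. \<alpha> p i)" if p: "p \<in> W" for p
  proof -
    have V': "\<sigma> p \<in> V" "\<psi> (\<sigma> p) \<in> coord_box n c s" "\<tau> p \<in> U"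
      using p by (auto simp: W_def)
    \<comment> \<open>Moving coordinate \<open>i\<close> of the second factor moves coordinate
      \<open>m + i\<close> of the product. The right-hand side depends on \<open>p\<close> through a
      fixed function \<open>K\<close>, which is what makes it smooth in \<open>p\<close>.\<close>
    have "partial_derivative i ((\<lambda>q. H (\<tau> p, q)) \<circ> inv_into V \<psi>) (\<psi> (\<sigma> p))
        = partial_derivative (m + i) K (coord_append m (\<phi> (\<tau> p)) (\<psi> (\<sigma> p)))" if i: "i < n" for i
    proof -
      have "partial_derivative i ((\<lambda>q. H (\<tau> p, q)) \<circ> inv_into V \<psi>) (\<psi> (\<sigma> p))
          = partial_derivative i (\<lambda>y. K (coord_append m (\<phi> (\<tau> p)) y)) (\<psi> (\<sigma> p))"
      proof (rule partial_derivative_cong[OF chart_image_open[OF cV] imageI[OF V'(1)] i])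
        fix y assume "y \<in> \<psi> ` V"
        then obtain q where "q \<in> V" "y = \<psi> q" by blast
        then show "((\<lambda>q. H (\<tau> p, q)) \<circ> inv_into V \<psi>) y = K (coord_append m (\<phi> (\<tau> p)) y)"
          by (simp add: K_def inv_into_product_chart[OF cU cV V'(3)] inv_into_f_f[OF chart_inj[OF cV]])
      qed
      then show ?thesis
        by (simp add: partial_derivative_def coord_append_fun_upd) (simp add: coord_append_def)
    qed
    then have "box_bump n c s (\<psi> (\<sigma> p)) * v p (\<lambda>q. H (\<tau> p, q))
        = (\<Sum>i<n. (v p (Y i) - \<psi> (\<sigma> p) i * v p \<beta>) * partial_derivative (m + i) K (coord_append m (\<phi> (\<tau> p)) (\<psi> (\<sigma> p))))"
      using tangent_vector_in_chart[OF MA V(1) r(2) s(1) V'(1,2) v smooth_function_slice[OF MB MA H]]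
      by (simp add: Y_def \<beta>_def)
    moreover have "box_bump n c s (\<psi> (\<sigma> p)) > 0"
      by (rule box_bump_pos[OF V'(2)])
    ultimately show ?thesis
      unfolding \<alpha>_def sum_distrib_left[symmetric]
      by (metis (no_types, lifting) diff_conv_add_uminus left_inverse less_irrefl mult.assoc mult_1 sum.cong)
  qed
  have \<sigma>W: "Ck_on l k (\<zeta> ` W) (\<lambda>x. \<psi> (\<sigma> (inv_into Z \<zeta> x)) j)" if "j < n" for j k
    by (rule Ck_on_subset[OF smooth_map_Ck[OF \<sigma> Z(1) V(1) that]]) (auto simp: W_def)
  have \<tau>W: "Ck_on l k (\<zeta> ` W) (\<lambda>x. \<phi> (\<tau> (inv_into Z \<zeta> x)) j)" if "j < m" for j k
    by (rule Ck_on_subset[OF smooth_map_Ck[OF \<tau> Z(1) U(1) that]]) (auto simp: W_def)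
  have vW: "Ck_on l k (\<zeta> ` W) (\<lambda>x. v (inv_into Z \<zeta> x) h)" if "h \<in> smooth_functions n A" for h k
    using Ck_on_subset[OF smooth_functions_Ck[OF vs[OF that] Z(1)] image_mono[OF WZ]] by (simp add: o_def)
  have "Ck_on l k (\<zeta> ` W) (\<lambda>x. \<Sum>i<n. \<alpha> (inv_into Z \<zeta> x) i)" for k
  proof (rule Ck_on_sum[OF T])
    fix i assume "i \<in> {..<n}"
    then have i: "i < n" by simp
    have "Ck_on l k (\<zeta> ` W) (\<lambda>x. box_bump n c s (\<psi> (\<sigma> (inv_into Z \<zeta> x))))"
      by (rule Ck_on_compose[OF T openin_coord_box _ \<sigma>W Ck_on_box_bump[OF openin_coord_box[of n c s]]])
        (auto simp: inv W_def)
    then have 1: "Ck_on l k (\<zeta> ` W) (\<lambda>x. inverse (box_bump n c s (\<psi> (\<sigma> (inv_into Z \<zeta> x)))))"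
    proof (rule Ck_on_inverse[OF T, rotated])
      fix x assume "x \<in> \<zeta> ` W"
      then have "\<psi> (\<sigma> (inv_into Z \<zeta> x)) \<in> coord_box n c s"
        using inv by (auto simp: W_def)
      from box_bump_pos[OF this] show "box_bump n c s (\<psi> (\<sigma> (inv_into Z \<zeta> x))) \<noteq> 0" by simp
    qed
    have O: "openin (Euclidean_space (m + n)) (?\<rho> ` (U \<times> V))"
      by (intro openin_product_chart_image[OF cU cV] chart_domain_open[OF cU] chart_domain_open[OF cV] order_refl)
    have 2: "Ck_on l k (\<zeta> ` W) (\<lambda>x. partial_derivative (m + i) K
        (coord_append m (\<phi> (\<tau> (inv_into Z \<zeta> x))) (\<psi> (\<sigma> (inv_into Z \<zeta> x)))))"
    proof (rule Ck_on_compose[OF T O, where f = "partial_derivative (m + i) K"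
          and G = "\<lambda>x. coord_append m (\<phi> (\<tau> (inv_into Z \<zeta> x))) (\<psi> (\<sigma> (inv_into Z \<zeta> x)))"])
      show "Ck_on (m + n) k (?\<rho> ` (U \<times> V)) (partial_derivative (m + i) K)"
        unfolding K_def by (rule Ck_on_SucD(1)[OF product_smooth_Ck[OF H U(1) V(1)]]) (use i in simp)
      show "Ck_on l k (\<zeta> ` W) (\<lambda>x. coord_append m (\<phi> (\<tau> (inv_into Z \<zeta> x))) (\<psi> (\<sigma> (inv_into Z \<zeta> x))) j)"
        if "j < m + n" for j
        by (rule Ck_on_coord_append[OF T \<tau>W \<sigma>W that])
      show "(\<lambda>x. coord_append m (\<phi> (\<tau> (inv_into Z \<zeta> x))) (\<psi> (\<sigma> (inv_into Z \<zeta> x)))) ` \<zeta> ` W \<subseteq> ?\<rho> ` (U \<times> V)"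
        using inv by (force simp: W_def)
    qed
    show "Ck_on l k (\<zeta> ` W) (\<lambda>x. \<alpha> (inv_into Z \<zeta> x) i)"
      unfolding \<alpha>_def
      by (intro Ck_on_mult[OF T] Ck_on_add[OF T] Ck_on_uminus[OF T] 1 2 vW Y \<beta> \<sigma>W i)
  qed
  then have "Ck_on l k (\<zeta> ` W) ((\<lambda>p. v p (\<lambda>q. H (\<tau> p, q))) \<circ> inv_into Z \<zeta>)" for k
  proof (rule Ck_on_cong_imp[OF T, rotated])
    fix x assume "x \<in> \<zeta> ` W"
    then show "(\<Sum>i<n. \<alpha> (inv_into Z \<zeta> x) i) = ((\<lambda>p. v p (\<lambda>q. H (\<tau> p, q))) \<circ> inv_into Z \<zeta>) x"
      using inv eq by auto
  qed
  then show "\<exists>U \<phi> W. (U, \<phi>) \<in> C \<and> open W \<and> p0 \<in> W \<and> W \<subseteq> U \<and>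
      (\<forall>k. Ck_on l k (\<phi> ` W) ((\<lambda>p. v p (\<lambda>q. H (\<tau> p, q))) \<circ> inv_into U \<phi>))"
    using Z(1) W p0W WZ by blast
qed

section \<open>Left-invariant frames\<close>

lemma partial_derivative_tangent:
  fixes A :: "('a::{t2_space, second_countable_topology}) chart set"
  assumes M: "smooth_manifold n A" and U: "(U, \<phi>) \<in> A" "p \<in> U" and i: "i < n"
  shows "(\<lambda>f. if f \<in> smooth_functions n A then partial_derivative i (f \<circ> inv_into U \<phi>) (\<phi> p) else 0)
    \<in> tangent_space n A p"
proof -
  note cU = smooth_manifold_chart[OF M U(1)]
  have inv: "inv_into U \<phi> (\<phi> p) = p"
    by (rule inv_into_f_f[OF chart_inj[OF cU] U(2)])
  have der: "((\<lambda>t. f (inv_into U \<phi> ((\<phi> p)(i := t)))) has_field_derivative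
      partial_derivative i (f \<circ> inv_into U \<phi>) (\<phi> p)) (at (\<phi> p i))" if "f \<in> smooth_functions n A" for f
    using Ck_on_SucD(2)[OF smooth_functions_Ck[OF that U(1), of "Suc 0"] i imageI[OF U(2)]] by simp
  have add: "partial_derivative i ((\<lambda>q. f q + g q) \<circ> inv_into U \<phi>) (\<phi> p)
      = partial_derivative i (f \<circ> inv_into U \<phi>) (\<phi> p) + partial_derivative i (g \<circ> inv_into U \<phi>) (\<phi> p)"
    if "f \<in> smooth_functions n A" "g \<in> smooth_functions n A" for f g
    using DERIV_add[OF der[OF that(1)] der[OF that(2)]] by (intro partial_derivative_eqI) simp
  have cmult: "partial_derivative i ((\<lambda>q. c * f q) \<circ> inv_into U \<phi>) (\<phi> p)
      = c * partial_derivative i (f \<circ> inv_into U \<phi>) (\<phi> p)" if "f \<in> smooth_functions n A" for c f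
    using DERIV_cmult[OF der[OF that]] by (intro partial_derivative_eqI) simp
  have mult: "partial_derivative i ((\<lambda>q. f q * g q) \<circ> inv_into U \<phi>) (\<phi> p)
      = partial_derivative i (f \<circ> inv_into U \<phi>) (\<phi> p) * g p + f p * partial_derivative i (g \<circ> inv_into U \<phi>) (\<phi> p)"
    if "f \<in> smooth_functions n A" "g \<in> smooth_functions n A" for f g
    using DERIV_mult[OF der[OF that(1)] der[OF that(2)]]
    by (intro partial_derivative_eqI) (simp add: inv mult.commute)
  show ?thesis
    unfolding tangent_space_def
    using smooth_functions_add[OF M] smooth_functions_cmult[OF M] smooth_functions_mult[OF M] add cmult mult
    by simp
qed

text \<open>The coordinate formula for derivations divided by the bump value at \<open>p\<close>.
  The test functions \<open>\<gamma> i\<close> are global and agree to first order at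
  \<open>p\<close> with the coordinates centred at \<open>p\<close>.\<close>

lemma tangent_space_coordinates:
  fixes A :: "('a::{t2_space, second_countable_topology}) chart set"
  assumes M: "smooth_manifold n A"
  shows "\<exists>\<gamma> w. (\<forall>i. \<gamma> i \<in> smooth_functions n A) \<and> (\<forall>i<n. w i \<in> tangent_space n A p) \<and>
    (\<forall>v\<in>tangent_space n A p. \<forall>f\<in>smooth_functions n A. v f = (\<Sum>i<n. v (\<gamma> i) * w i f))"
proof -
  obtain U \<phi> where U: "(U, \<phi>) \<in> A" "p \<in> U"
    using smooth_manifold_cover[OF M] by metis
  note cU = smooth_manifold_chart[OF M U(1)]
  define c where "c = \<phi> p"
  have "c \<in> \<phi> ` U" using U(2) by (simp add: c_def)
  then obtain r where r: "r > 0" "coord_box n c r \<subseteq> \<phi> ` U"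
    using openin_contains_coord_box[OF chart_image_open[OF cU]] by metis
  define s where "s = r / 2"
  have s: "s < r" "s > 0" using r(1) by (simp_all add: s_def)
  have cs: "\<phi> p \<in> coord_box n c s"
    using U(2) s openin_subset[OF chart_image_open[OF cU]] by (auto simp: coord_box_def c_def)
  define \<beta> where "\<beta> = bump_extension n (U, \<phi>) c s (\<lambda>_. 1)"
  define Y where "Y = (\<lambda>i. bump_extension n (U, \<phi>) c s (\<lambda>x. x i))"
  have \<beta>: "\<beta> \<in> smooth_functions n A" and Y: "Y i \<in> smooth_functions n A" for i
    unfolding \<beta>_def Y_def
    by (intro bump_extension_smooth[OF M U(1) r(2) s(1)] Ck_on_const Ck_on_coord openin_coord_box)+
  define b where "b = box_bump n c s (\<phi> p)"
  have b: "b > 0"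
    unfolding b_def by (rule box_bump_pos[OF cs])
  \<comment> \<open>In the chart this is the bump times the centred coordinate, normalised by the
    value \<open>b\<close> of the bump at \<open>p\<close>.\<close>
  define \<gamma> where "\<gamma> = (\<lambda>i q. inverse b * (Y i q - c i * \<beta> q))"
  define w where "w = (\<lambda>i f. if f \<in> smooth_functions n A then partial_derivative i (f \<circ> inv_into U \<phi>) (\<phi> p) else 0)"
  show ?thesis
  proof (intro exI[of _ \<gamma>] exI[of _ w] conjI allI ballI impI)
    show "\<gamma> i \<in> smooth_functions n A" for i
      unfolding \<gamma>_def by (intro smooth_functions_cmult[OF M] smooth_functions_diff[OF M] Y \<beta>)
    show "w i \<in> tangent_space n A p" if "i < n" for i
      unfolding w_def by (rule partial_derivative_tangent[OF M U that])
    fix v f assume v: "v \<in> tangent_space n A p" and f: "f \<in> smooth_functions n A"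
    have "v (\<gamma> i) = inverse b * (v (Y i) - c i * v \<beta>)" for i
      unfolding \<gamma>_def
      by (simp add: tangent_cmult[OF v] tangent_diff[OF v M] smooth_functions_diff[OF M]
          smooth_functions_cmult[OF M] Y \<beta>)
    then have "(\<Sum>i<n. v (\<gamma> i) * w i f)
        = inverse b * (\<Sum>i<n. (v (Y i) - c i * v \<beta>) * partial_derivative i (f \<circ> inv_into U \<phi>) (\<phi> p))"
      using f by (simp add: w_def sum_distrib_left mult.assoc)
    also have "\<dots> = inverse b * (b * v f)"
      using tangent_vector_in_chart[OF M U(1) r(2) s(1) U(2) cs v f] by (simp add: b_def \<beta>_def Y_def c_def)
    also have "\<dots> = v f"
      using b by simp
    finally show "v f = (\<Sum>i<n. v (\<gamma> i) * w i f)" by simp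
  qed
qed

section \<open>Left translations and the left-invariant frame of a Lie group\<close>

context
  fixes n :: nat and A :: "('g::{t2_space, second_countable_topology}) chart set"
    and gmult :: "'g \<Rightarrow> 'g \<Rightarrow> 'g" and e :: 'g and ginv :: "'g \<Rightarrow> 'g"
  assumes G: "lie_group n A gmult e ginv"
begin

interpretation grp: group gmult e ginv
  using G by (simp add: lie_group_def)

lemma lie_group_manifold: "smooth_manifold n A"
  using G by (simp add: lie_group_def)

lemma smooth_functions_gmult:
  assumes "f \<in> smooth_functions n A"
  shows "(\<lambda>(p, q). f (gmult p q)) \<in> smooth_functions (n + n) (product_atlas n A A)"
proof -
  have "f \<circ> (\<lambda>(p, q). gmult p q) \<in> smooth_functions (n + n) (product_atlas n A A)"
    using G by (intro smooth_functions_compose_product[OF lie_group_manifold lie_group_manifold lie_group_manifold _ assms])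
      (simp add: lie_group_def)
  then show ?thesis
    by (simp add: o_def case_prod_unfold)
qed

lemma smooth_functions_left_translate:
  assumes "f \<in> smooth_functions n A"
  shows "(\<lambda>q. f (gmult p q)) \<in> smooth_functions n A"
  using smooth_function_slice[OF lie_group_manifold lie_group_manifold smooth_functions_gmult[OF assms], of p]
  by simp

lemma pushforward_left_translate:
  "f \<in> smooth_functions n A \<Longrightarrow> pushforward n A (gmult p) v f = v (\<lambda>q. f (gmult p q))"
  by (simp add: pushforward_def o_def)

lemma pushforward_left_translate_tangent:
  assumes v: "v \<in> tangent_space n A q"
  shows "pushforward n A (gmult p) v \<in> tangent_space n A (gmult p q)"
  using smooth_functions_add[OF lie_group_manifold] smooth_functions_cmult[OF lie_group_manifold]
    smooth_functions_mult[OF lie_group_manifold] smooth_functions_left_translate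
    tangent_add[OF v] tangent_cmult[OF v] tangent_mult[OF v]
  by (simp add: tangent_space_def pushforward_def o_def)

lemma pushforward_left_translate_comp:
  "pushforward n A (gmult p) (pushforward n A (gmult q) v) = pushforward n A (gmult (gmult p q)) v"
  using smooth_functions_left_translate
  by (auto simp: pushforward_def o_def fun_eq_iff grp.assoc)

text \<open>Invariance follows from associativity. Smoothness in \<open>p\<close> is the substantial
  point: \<open>v\<close> differentiates the smooth function \<open>f (gmult p q)\<close> of two
  variables in \<open>q\<close> at \<open>e\<close>.\<close>

lemma left_invariant_extension:
  assumes v: "v \<in> tangent_space n A e"
  shows "(\<lambda>p. pushforward n A (gmult p) v) \<in> left_invariant_vector_fields n A gmult"
proof -
  note M = lie_group_manifold
  have "pushforward n A (gmult p) v \<in> tangent_space n A p" for p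
    using pushforward_left_translate_tangent[OF v, of p] by simp
  moreover have "(\<lambda>p. pushforward n A (gmult p) v f) \<in> smooth_functions n A"
    if f: "f \<in> smooth_functions n A" for f
    \<comment> \<open>Here \<open>\<tau>\<close> is the identity and \<open>\<sigma>\<close> is
      constantly \<open>e\<close>.\<close>
    using smooth_partial_tangent[OF M M M smooth_map_id[OF M] smooth_map_const[OF M, of n A e], of "\<lambda>_. v",
        OF v smooth_functions_const[OF M] smooth_functions_gmult[OF f]]
    by (simp add: pushforward_left_translate[OF f])
  ultimately show ?thesis
    using pushforward_left_translate_comp
    by (simp add: left_invariant_vector_fields_def vector_fields_def)
qed

text \<open>Left translation by \<open>gmult q (ginv p)\<close> carries \<open>p\<close> to
  \<open>q\<close>, so the value at \<open>p\<close> determines the value at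
  \<open>q\<close>.\<close>

lemma left_invariant_eqI:
  assumes X: "X \<in> left_invariant_vector_fields n A gmult" and Y: "Y \<in> left_invariant_vector_fields n A gmult"
    and "X p = Y p"
  shows "X = Y"
proof
  fix q
  have eq: "gmult (gmult q (ginv p)) p = q"
    by (simp add: grp.assoc)
  have "Z q = pushforward n A (gmult (gmult q (ginv p))) (Z p)" if "Z \<in> left_invariant_vector_fields n A gmult" for Z
  proof -
    have "pushforward n A (gmult (gmult q (ginv p))) (Z p) = Z (gmult (gmult q (ginv p)) p)"
      using that by (simp add: left_invariant_vector_fields_def)
    then show ?thesis
      by (simp only: eq)
  qed
  from this[OF X] this[OF Y] show "X q = Y q"
    by (simp only: \<open>X p = Y p\<close>)
qed

text \<open>Translate \<open>X p\<close> back to \<open>e\<close>, expand it there in the vectors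
  \<open>w i\<close>, and translate forward again. The coefficients come from the test functions
  \<open>\<gamma> i\<close>; independence of the \<open>E i\<close> is not asserted.\<close>

lemma left_invariant_frame:
  "\<exists>E \<kappa>. (\<forall>i<n. E i \<in> left_invariant_vector_fields n A gmult) \<and>
    (\<forall>X\<in>vector_fields n A. (\<forall>i. \<kappa> X i \<in> smooth_functions n A) \<and>
      (\<forall>p. \<forall>f\<in>smooth_functions n A. X p f = (\<Sum>i<n. \<kappa> X i p * E i p f)))"
proof -
  note M = lie_group_manifold
  obtain \<gamma> :: "nat \<Rightarrow> 'g \<Rightarrow> real" and w
    where \<gamma>': "\<forall>i. \<gamma> i \<in> smooth_functions n A" and w: "\<forall>i<n. w i \<in> tangent_space n A e"
      and vw: "\<forall>v\<in>tangent_space n A e. \<forall>f\<in>smooth_functions n A. v f = (\<Sum>i<n. v (\<gamma> i) * w i f)"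
    using tangent_space_coordinates[OF M, of e] by (elim exE conjE)
  note \<gamma> = \<gamma>'[rule_format]
  define E where "E = (\<lambda>i p. pushforward n A (gmult p) (w i))"
  \<comment> \<open>The value on \<open>\<gamma> i\<close> of \<open>X p\<close> translated to
    \<open>e\<close>.\<close>
  define \<kappa> where "\<kappa> = (\<lambda>(X::'g vfield) i p. X p (\<lambda>q. \<gamma> i (gmult (ginv p) q)))"
  show ?thesis
  proof (intro exI[of _ E] exI[of _ \<kappa>] conjI allI ballI impI)
    show "E i \<in> left_invariant_vector_fields n A gmult" if "i < n" for i
      unfolding E_def by (rule left_invariant_extension) (use w that in blast)
    fix X assume X: "X \<in> vector_fields n A"
    have ginv: "smooth_map n A n A ginv"
      using G by (simp add: lie_group_def)
    have XT: "X p \<in> tangent_space n A p" for p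
      using X by (simp add: vector_fields_def)
    \<comment> \<open>Here \<open>\<tau>\<close> is inversion and \<open>\<sigma>\<close> the
      identity, so smoothness of the inverse enters at this point.\<close>
    have "(\<lambda>p. X p (\<lambda>q. (\<lambda>(p, q). \<gamma> i (gmult p q)) (ginv p, q))) \<in> smooth_functions n A" for i
      by (rule smooth_partial_tangent[OF M M M ginv smooth_map_id[OF M] XT _ smooth_functions_gmult[OF \<gamma>]])
        (use X in \<open>simp add: vector_fields_def\<close>)
    then show "\<kappa> X i \<in> smooth_functions n A" for i
      by (simp add: \<kappa>_def)
    fix p f assume f: "f \<in> smooth_functions n A"
    define v where "v = pushforward n A (gmult (ginv p)) (X p)"
    have v: "v \<in> tangent_space n A e"
      using pushforward_left_translate_tangent[OF XT, of "ginv p" p] by (simp add: v_def)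
    have "X p f = v (\<lambda>q. f (gmult p q))"
      by (simp add: v_def pushforward_left_translate[OF smooth_functions_left_translate[OF f]] flip: grp.assoc)
    also have "\<dots> = (\<Sum>i<n. v (\<gamma> i) * w i (\<lambda>q. f (gmult p q)))"
      by (rule vw[rule_format, OF v smooth_functions_left_translate[OF f]])
    also have "\<dots> = (\<Sum>i<n. \<kappa> X i p * E i p f)"
      by (simp add: v_def \<kappa>_def E_def pushforward_left_translate[OF \<gamma>] pushforward_left_translate[OF f])
    finally show "X p f = (\<Sum>i<n. \<kappa> X i p * E i p f)" .
  qed
qed

end

section \<open>Trivialised vector fields\<close>

text \<open>Collects what the construction needs from the group: a linear family of fields that is
  injective at every point and hits every vector field through a smooth coefficient function.
  Left-symmetric is another name for quasiassociative.\<close>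

locale left_symmetric_trivialization =
  fixes n :: nat and A :: "('g::{t2_space, second_countable_topology}) chart set"
    and \<Phi> :: "'r::real_vector \<Rightarrow> 'g vfield" and \<alpha> :: "'g vfield \<Rightarrow> 'g \<Rightarrow> 'r"
    and B :: "'r set" and rmult :: "'r \<Rightarrow> 'r \<Rightarrow> 'r"
  assumes M: "smooth_manifold n A"
    and B: "finite B" "independent B" "span B = UNIV"
    and \<Phi>_vf: "\<And>a. \<Phi> a \<in> vector_fields n A"
    and \<Phi>_add: "\<And>a b. \<Phi> (a + b) = vf_add (\<Phi> a) (\<Phi> b)"
    and \<Phi>_scale: "\<And>c a. \<Phi> (c *\<^sub>R a) = vf_scale c (\<Phi> a)"
    and \<Phi>_inj: "\<And>a b p. \<Phi> a p = \<Phi> b p \<Longrightarrow> a = b"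
    and \<Phi>_\<alpha>: "\<And>X p. X \<in> vector_fields n A \<Longrightarrow> \<Phi> (\<alpha> X p) p = X p"
    and \<alpha>_smooth: "\<And>X b. X \<in> vector_fields n A \<Longrightarrow> (\<lambda>p. representation B (\<alpha> X p) b) \<in> smooth_functions n A"
    and bil: "bilinear rmult"
    and qa: "\<And>a b c. rmult a (rmult b c) - rmult (rmult a b) c = rmult b (rmult a c) - rmult (rmult b a) c"
    and bracket: "\<And>a b. \<Phi> (rmult a b - rmult b a) = vf_bracket (\<Phi> a) (\<Phi> b)"
begin

abbreviation coord :: "'r \<Rightarrow> 'r \<Rightarrow> real" where
  "coord b a \<equiv> representation B a b"

definition smooth_vec :: "('g \<Rightarrow> 'r) set" where
  "smooth_vec = {u. \<forall>b. (\<lambda>p. coord b (u p)) \<in> smooth_functions n A}"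

definition vec_deriv :: "(('g \<Rightarrow> real) \<Rightarrow> real) \<Rightarrow> ('g \<Rightarrow> 'r) \<Rightarrow> 'r" where
  "vec_deriv v u = (\<Sum>b\<in>B. v (\<lambda>q. coord b (u q)) *\<^sub>R b)"

lemma sum_coord: "(\<Sum>b\<in>B. coord b a *\<^sub>R b) = a"
  by (rule real_vector.sum_representation_eq[OF B(2)]) (simp_all add: B)

lemma coord_sum: "coord b (\<Sum>i\<in>I. c i *\<^sub>R a i) = (\<Sum>i\<in>I. c i * coord b (a i))"
  by (simp add: real_vector.representation_sum[OF B(2)] real_vector.representation_scale[OF B(2)] B(3))

lemma vector_field_tangent: "X \<in> vector_fields n A \<Longrightarrow> X p \<in> tangent_space n A p"
  and vector_field_smooth: "X \<in> vector_fields n A \<Longrightarrow> f \<in> smooth_functions n A \<Longrightarrow> (\<lambda>p. X p f) \<in> smooth_functions n A"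
  and vector_field_non_smooth: "X \<in> vector_fields n A \<Longrightarrow> f \<notin> smooth_functions n A \<Longrightarrow> X p f = 0"
  by (auto simp: vector_fields_def tangent_space_def)

lemma \<Phi>_add_apply: "\<Phi> (a + b) p f = \<Phi> a p f + \<Phi> b p f"
  and \<Phi>_scale_apply: "\<Phi> (c *\<^sub>R a) p f = c * \<Phi> a p f"
  by (simp_all add: \<Phi>_add \<Phi>_scale vf_add_def vf_scale_def)

lemma \<Phi>_diff_apply: "\<Phi> (a - b) p f = \<Phi> a p f - \<Phi> b p f"
  using \<Phi>_add_apply[of "a - b" b p f] by simp

lemma \<Phi>_sum_apply: "\<Phi> (\<Sum>i\<in>I. c i *\<^sub>R a i) p f = (\<Sum>i\<in>I. c i * \<Phi> (a i) p f)"
proof -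
  have "\<Phi> 0 p f = 0"
    using \<Phi>_scale_apply[of 0 0 p f] by simp
  then show ?thesis
    by (induction I rule: infinite_finite_induct) (simp_all add: \<Phi>_add_apply \<Phi>_scale_apply)
qed

lemma \<Phi>_expand: "\<Phi> a p f = (\<Sum>b\<in>B. coord b a * \<Phi> b p f)"
  using \<Phi>_sum_apply[of "\<lambda>b. coord b a" "\<lambda>b. b" B p f] by (simp add: sum_coord)

lemma smooth_vecD: "u \<in> smooth_vec \<Longrightarrow> (\<lambda>p. coord b (u p)) \<in> smooth_functions n A"
  by (simp add: smooth_vec_def)

lemma \<alpha>_smooth_vec: "X \<in> vector_fields n A \<Longrightarrow> \<alpha> X \<in> smooth_vec"
  by (simp add: smooth_vec_def \<alpha>_smooth)

lemma smooth_vec_sum: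
  assumes "\<And>i. i \<in> I \<Longrightarrow> g i \<in> smooth_functions n A"
  shows "(\<lambda>p. \<Sum>i\<in>I. g i p *\<^sub>R a i) \<in> smooth_vec"
  unfolding smooth_vec_def
proof clarify
  fix b
  have "(\<lambda>p. g i p * coord b (a i)) \<in> smooth_functions n A" if "i \<in> I" for i
    by (intro smooth_functions_mult[OF M] smooth_functions_const[OF M] assms that)
  then show "(\<lambda>p. coord b (\<Sum>i\<in>I. g i p *\<^sub>R a i)) \<in> smooth_functions n A"
    unfolding coord_sum by (rule smooth_functions_sum[OF M])
qed

text \<open>The vectors \<open>a i\<close> need not be basis vectors: the derivative is computed
  correctly from any expansion with constant vectors, in particular from products of basis
  vectors.\<close>

lemma vec_deriv_sum:
  assumes v: "v \<in> tangent_space n A p" and g: "\<And>i. i \<in> I \<Longrightarrow> g i \<in> smooth_functions n A"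
  shows "vec_deriv v (\<lambda>q. \<Sum>i\<in>I. g i q *\<^sub>R a i) = (\<Sum>i\<in>I. v (g i) *\<^sub>R a i)"
proof -
  have "v (\<lambda>q. coord b (\<Sum>i\<in>I. g i q *\<^sub>R a i)) = coord b (\<Sum>i\<in>I. v (g i) *\<^sub>R a i)" for b
  proof -
    have "v (\<lambda>q. coord b (\<Sum>i\<in>I. g i q *\<^sub>R a i)) = v (\<lambda>q. \<Sum>i\<in>I. coord b (a i) * g i q)"
      unfolding coord_sum by (simp only: mult.commute)
    also have "\<dots> = (\<Sum>i\<in>I. v (\<lambda>q. coord b (a i) * g i q))"
      by (rule tangent_sum[OF v M]) (rule smooth_functions_cmult[OF M g])
    also have "\<dots> = (\<Sum>i\<in>I. v (g i) * coord b (a i))"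
    proof (rule sum.cong[OF refl])
      fix i assume "i \<in> I"
      from tangent_cmult[OF v g[OF this]]
      show "v (\<lambda>q. coord b (a i) * g i q) = v (g i) * coord b (a i)"
        by (rule trans) (rule mult.commute)
    qed
    finally show ?thesis
      unfolding coord_sum .
  qed
  then show ?thesis
    by (simp add: vec_deriv_def sum_coord)
qed

lemma smooth_vec_add:
  assumes "u \<in> smooth_vec" "w \<in> smooth_vec"
  shows "(\<lambda>p. u p + w p) \<in> smooth_vec"
  using assms smooth_functions_add[OF M]
  by (simp add: smooth_vec_def real_vector.representation_add[OF B(2)] B(3))

lemma vec_deriv_add:
  assumes v: "v \<in> tangent_space n A p" and "u \<in> smooth_vec" "w \<in> smooth_vec"
  shows "vec_deriv v (\<lambda>p. u p + w p) = vec_deriv v u + vec_deriv v w"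
  using tangent_add[OF v smooth_vecD[OF assms(2)] smooth_vecD[OF assms(3)]]
  by (simp add: vec_deriv_def real_vector.representation_add[OF B(2)] B(3) sum.distrib scaleR_add_left)

lemma vec_deriv_scale:
  assumes v: "v \<in> tangent_space n A p" and "u \<in> smooth_vec"
  shows "vec_deriv v (\<lambda>p. c *\<^sub>R u p) = c *\<^sub>R vec_deriv v u"
  using tangent_cmult[OF v smooth_vecD[OF assms(2)]]
  by (simp add: vec_deriv_def real_vector.representation_scale[OF B(2)] B(3) scaleR_right.sum)

text \<open>Isolates the constant products of basis vectors, so that smoothness and the Leibniz rule
  for \<open>rmult\<close> reduce to those for real functions.\<close>

lemma rmult_expand:
  "(\<lambda>q. rmult (u q) (w q)) =
    (\<lambda>q. \<Sum>z\<in>B \<times> B. (coord (fst z) (u q) * coord (snd z) (w q)) *\<^sub>R rmult (fst z) (snd z))"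
proof
  fix q
  have "rmult (\<Sum>a\<in>B. coord a (u q) *\<^sub>R a) (\<Sum>b\<in>B. coord b (w q) *\<^sub>R b)
      = (\<Sum>z\<in>B \<times> B. (coord (fst z) (u q) * coord (snd z) (w q)) *\<^sub>R rmult (fst z) (snd z))"
    unfolding bilinear_sum[OF bil]
    by (rule sum.cong) (auto simp: bilinear_lmul[OF bil] bilinear_rmul[OF bil])
  then show "rmult (u q) (w q) = (\<Sum>z\<in>B \<times> B. (coord (fst z) (u q) * coord (snd z) (w q)) *\<^sub>R rmult (fst z) (snd z))"
    by (simp only: sum_coord)
qed

lemma smooth_vec_rmult:
  assumes "u \<in> smooth_vec" "w \<in> smooth_vec"
  shows "(\<lambda>p. rmult (u p) (w p)) \<in> smooth_vec"
  by (subst rmult_expand) (intro smooth_vec_sum smooth_functions_mult[OF M] smooth_vecD assms)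

lemma vec_deriv_rmult:
  assumes v: "v \<in> tangent_space n A p" and u: "u \<in> smooth_vec" and w: "w \<in> smooth_vec"
  shows "vec_deriv v (\<lambda>q. rmult (u q) (w q)) = rmult (vec_deriv v u) (w p) + rmult (u p) (vec_deriv v w)"
proof -
  have "vec_deriv v (\<lambda>q. rmult (u q) (w q))
      = (\<Sum>z\<in>B \<times> B. v (\<lambda>q. coord (fst z) (u q) * coord (snd z) (w q)) *\<^sub>R rmult (fst z) (snd z))"
    by (subst rmult_expand, rule vec_deriv_sum[OF v]) (intro smooth_functions_mult[OF M] smooth_vecD u w)
  also have "\<dots> = (\<Sum>z\<in>B \<times> B. (v (\<lambda>q. coord (fst z) (u q)) * coord (snd z) (w p)) *\<^sub>R rmult (fst z) (snd z)
      + (coord (fst z) (u p) * v (\<lambda>q. coord (snd z) (w q))) *\<^sub>R rmult (fst z) (snd z))"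
    by (simp add: tangent_mult[OF v smooth_vecD[OF u] smooth_vecD[OF w]] scaleR_add_left)
  also have "\<dots> = rmult (\<Sum>a\<in>B. v (\<lambda>q. coord a (u q)) *\<^sub>R a) (\<Sum>b\<in>B. coord b (w p) *\<^sub>R b)
      + rmult (\<Sum>a\<in>B. coord a (u p) *\<^sub>R a) (\<Sum>b\<in>B. v (\<lambda>q. coord b (w q)) *\<^sub>R b)"
    unfolding bilinear_sum[OF bil] sum.distrib
    by (simp add: bilinear_lmul[OF bil] bilinear_rmul[OF bil] case_prod_unfold mult.commute)
  also have "\<dots> = rmult (vec_deriv v u) (w p) + rmult (u p) (vec_deriv v w)"
    by (simp only: sum_coord vec_deriv_def)
  finally show ?thesis .
qed

lemma smooth_vec_deriv:
  assumes "X \<in> vector_fields n A" "u \<in> smooth_vec"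
  shows "(\<lambda>p. vec_deriv (X p) u) \<in> smooth_vec"
  unfolding vec_deriv_def by (rule smooth_vec_sum) (rule vector_field_smooth[OF assms(1) smooth_vecD[OF assms(2)]])

text \<open>The inverse of \<open>\<alpha>\<close>; together the two identify vector fields with
  smooth algebra-valued functions.\<close>

definition section_field :: "('g \<Rightarrow> 'r) \<Rightarrow> 'g vfield" where
  "section_field u p = \<Phi> (u p) p"

lemma section_field_in:
  assumes u: "u \<in> smooth_vec"
  shows "section_field u \<in> vector_fields n A"
proof -
  have "(\<lambda>p. \<Sum>b\<in>B. coord b (u p) * \<Phi> b p f) \<in> smooth_functions n A" if f: "f \<in> smooth_functions n A" for f
    by (intro smooth_functions_sum[OF M] smooth_functions_mult[OF M] smooth_vecD[OF u] vector_field_smooth[OF \<Phi>_vf f])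
  then show ?thesis
    using vector_field_tangent[OF \<Phi>_vf] by (simp add: vector_fields_def section_field_def flip: \<Phi>_expand)
qed

lemma \<alpha>_section_field: "u \<in> smooth_vec \<Longrightarrow> \<alpha> (section_field u) p = u p"
  using \<Phi>_\<alpha>[OF section_field_in] by (intro \<Phi>_inj[where p = p]) (simp add: section_field_def)

section \<open>The product of vector fields and its algebraic laws\<close>

definition vprod_vec :: "'g vfield \<Rightarrow> 'g vfield \<Rightarrow> 'g \<Rightarrow> 'r" where
  "vprod_vec X Y p = vec_deriv (X p) (\<alpha> Y) + rmult (\<alpha> X p) (\<alpha> Y p)"

definition vprod :: "'g vfield \<Rightarrow> 'g vfield \<Rightarrow> 'g vfield" where
  "vprod X Y = section_field (vprod_vec X Y)"

lemma vprod_vec_smooth: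
  assumes X: "X \<in> vector_fields n A" and Y: "Y \<in> vector_fields n A"
  shows "vprod_vec X Y \<in> smooth_vec"
  unfolding vprod_vec_def[abs_def]
  by (intro smooth_vec_add smooth_vec_deriv smooth_vec_rmult \<alpha>_smooth_vec X Y)

lemma vprod_in: "X \<in> vector_fields n A \<Longrightarrow> Y \<in> vector_fields n A \<Longrightarrow> vprod X Y \<in> vector_fields n A"
  unfolding vprod_def by (intro section_field_in vprod_vec_smooth)

lemma \<alpha>_vprod:
  "X \<in> vector_fields n A \<Longrightarrow> Y \<in> vector_fields n A \<Longrightarrow>
    \<alpha> (vprod X Y) p = vec_deriv (X p) (\<alpha> Y) + rmult (\<alpha> X p) (\<alpha> Y p)"
  unfolding vprod_def by (simp add: \<alpha>_section_field[OF vprod_vec_smooth] vprod_vec_def)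

lemma vprod_apply: "vprod X Y p = \<Phi> (vprod_vec X Y p) p"
  by (simp add: vprod_def section_field_def)

text \<open>The sum is the section field of the sum of the coefficient functions, so membership is
  inherited from \<open>smooth_vec\<close>.\<close>

lemma vf_add_in:
  assumes X: "X \<in> vector_fields n A" and Y: "Y \<in> vector_fields n A"
  shows "vf_add X Y \<in> vector_fields n A"
  using section_field_in[OF smooth_vec_add[OF \<alpha>_smooth_vec[OF X] \<alpha>_smooth_vec[OF Y]]]
  by (simp add: section_field_def[abs_def] \<Phi>_add vf_add_def \<Phi>_\<alpha> X Y)

lemma vf_scale_in:
  assumes X: "X \<in> vector_fields n A"
  shows "vf_scale c X \<in> vector_fields n A"
proof -
  have "(\<lambda>p. c *\<^sub>R \<alpha> X p) \<in> smooth_vec"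
    using smooth_functions_cmult[OF M smooth_vecD[OF \<alpha>_smooth_vec[OF X]]]
    by (simp add: smooth_vec_def real_vector.representation_scale[OF B(2)] B(3))
  from section_field_in[OF this] show ?thesis
    by (simp add: section_field_def[abs_def] \<Phi>_scale vf_scale_def \<Phi>_\<alpha> X)
qed

lemma \<alpha>_add:
  assumes X: "X \<in> vector_fields n A" and Y: "Y \<in> vector_fields n A"
  shows "\<alpha> (vf_add X Y) p = \<alpha> X p + \<alpha> Y p"
  using \<Phi>_\<alpha>[OF vf_add_in[OF X Y]]
  by (intro \<Phi>_inj[where p = p]) (simp add: \<Phi>_add vf_add_def \<Phi>_\<alpha> X Y)

lemma \<alpha>_scale:
  assumes X: "X \<in> vector_fields n A"
  shows "\<alpha> (vf_scale c X) p = c *\<^sub>R \<alpha> X p"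
  using \<Phi>_\<alpha>[OF vf_scale_in[OF X]]
  by (intro \<Phi>_inj[where p = p]) (simp add: \<Phi>_scale vf_scale_def \<Phi>_\<alpha> X)

lemma vec_deriv_vf_add: "vec_deriv (vf_add X Y p) u = vec_deriv (X p) u + vec_deriv (Y p) u"
  by (simp add: vec_deriv_def vf_add_def scaleR_add_left sum.distrib)

lemma vec_deriv_vf_scale: "vec_deriv (vf_scale c X p) u = c *\<^sub>R vec_deriv (X p) u"
  by (simp add: vec_deriv_def vf_scale_def scaleR_right.sum)

lemma section_field_add: "section_field (\<lambda>p. u p + w p) = vf_add (section_field u) (section_field w)"
  by (simp add: section_field_def[abs_def] \<Phi>_add vf_add_def)

lemma section_field_scale: "section_field (\<lambda>p. c *\<^sub>R u p) = vf_scale c (section_field u)"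
  by (simp add: section_field_def[abs_def] \<Phi>_scale vf_scale_def)

lemma vprod_bilinear: "vf_bilinear_on (vector_fields n A) vprod"
proof -
  have 1: "vprod_vec (vf_add X Y) Z = (\<lambda>p. vprod_vec X Z p + vprod_vec Y Z p)"
    if "X \<in> vector_fields n A" "Y \<in> vector_fields n A" for X Y Z
    by (simp add: fun_eq_iff vprod_vec_def vec_deriv_vf_add \<alpha>_add that bilinear_ladd[OF bil])
  have 2: "vprod_vec Z (vf_add X Y) = (\<lambda>p. vprod_vec Z X p + vprod_vec Z Y p)"
    if X: "X \<in> vector_fields n A" and Y: "Y \<in> vector_fields n A" and Z: "Z \<in> vector_fields n A" for X Y Z
  proof
    fix p
    have "\<alpha> (vf_add X Y) = (\<lambda>p. \<alpha> X p + \<alpha> Y p)"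
      by (simp add: fun_eq_iff \<alpha>_add X Y)
    then show "vprod_vec Z (vf_add X Y) p = vprod_vec Z X p + vprod_vec Z Y p"
      by (simp add: vprod_vec_def vec_deriv_add[OF vector_field_tangent[OF Z] \<alpha>_smooth_vec[OF X] \<alpha>_smooth_vec[OF Y]]
          bilinear_radd[OF bil])
  qed
  have 3: "vprod_vec (vf_scale c X) Y = (\<lambda>p. c *\<^sub>R vprod_vec X Y p)" if "X \<in> vector_fields n A" for c X Y
    by (simp add: fun_eq_iff vprod_vec_def vec_deriv_vf_scale \<alpha>_scale that bilinear_lmul[OF bil] scaleR_add_right)
  have 4: "vprod_vec X (vf_scale c Y) = (\<lambda>p. c *\<^sub>R vprod_vec X Y p)"
    if X: "X \<in> vector_fields n A" and Y: "Y \<in> vector_fields n A" for c X Y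
  proof
    fix p
    have "\<alpha> (vf_scale c Y) = (\<lambda>p. c *\<^sub>R \<alpha> Y p)"
      by (simp add: fun_eq_iff \<alpha>_scale Y)
    then show "vprod_vec X (vf_scale c Y) p = c *\<^sub>R vprod_vec X Y p"
      by (simp add: vprod_vec_def vec_deriv_scale[OF vector_field_tangent[OF X] \<alpha>_smooth_vec[OF Y]]
          bilinear_rmul[OF bil] scaleR_add_right)
  qed
  show ?thesis
    unfolding vf_bilinear_on_def vprod_def
    by (simp add: 1 2 3 4 section_field_add section_field_scale)
qed

lemma vector_field_iterate:
  assumes X: "X \<in> vector_fields n A" and Y: "Y \<in> vector_fields n A" and f: "f \<in> smooth_functions n A"
  shows "X p (\<lambda>q. Y q f) = \<Phi> (vec_deriv (X p) (\<alpha> Y)) p f + \<Phi> (\<alpha> X p) p (\<lambda>q. \<Phi> (\<alpha> Y p) q f)"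
proof -
  have sm: "(\<lambda>q. coord b (\<alpha> Y q)) \<in> smooth_functions n A" "(\<lambda>q. \<Phi> b q f) \<in> smooth_functions n A" for b
    by (rule smooth_vecD[OF \<alpha>_smooth_vec[OF Y]], rule vector_field_smooth[OF \<Phi>_vf f])
  note v = vector_field_tangent[OF X, of p]
  have "Y q f = (\<Sum>b\<in>B. coord b (\<alpha> Y q) * \<Phi> b q f)" for q
    using \<Phi>_expand[of "\<alpha> Y q" q f] by (simp add: \<Phi>_\<alpha>[OF Y])
  then have "X p (\<lambda>q. Y q f) = (\<Sum>b\<in>B. X p (\<lambda>q. coord b (\<alpha> Y q) * \<Phi> b q f))"
    using tangent_sum[OF v M, of B "\<lambda>b q. coord b (\<alpha> Y q) * \<Phi> b q f"] smooth_functions_mult[OF M sm] by simp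
  also have "\<dots> = (\<Sum>b\<in>B. X p (\<lambda>q. coord b (\<alpha> Y q)) * \<Phi> b p f) + (\<Sum>b\<in>B. coord b (\<alpha> Y p) * X p (\<lambda>q. \<Phi> b q f))"
    by (simp add: tangent_mult[OF v sm] sum.distrib)
  also have "(\<Sum>b\<in>B. X p (\<lambda>q. coord b (\<alpha> Y q)) * \<Phi> b p f) = \<Phi> (vec_deriv (X p) (\<alpha> Y)) p f"
    by (simp add: vec_deriv_def \<Phi>_sum_apply)
  \<comment> \<open>The coefficients are now constants, so they may be taken back under the
    derivation and reassembled into \<open>\<Phi> (\<alpha> Y p)\<close>.\<close>
  also have "(\<Sum>b\<in>B. coord b (\<alpha> Y p) * X p (\<lambda>q. \<Phi> b q f)) = (\<Sum>b\<in>B. X p (\<lambda>q. coord b (\<alpha> Y p) * \<Phi> b q f))"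
    by (simp add: tangent_cmult[OF v sm(2)])
  also have "\<dots> = X p (\<lambda>q. \<Sum>b\<in>B. coord b (\<alpha> Y p) * \<Phi> b q f)"
    by (rule tangent_sum[OF v M, symmetric]) (rule smooth_functions_cmult[OF M sm(2)])
  also have "\<dots> = \<Phi> (\<alpha> X p) p (\<lambda>q. \<Phi> (\<alpha> Y p) q f)"
    by (simp add: \<Phi>_\<alpha>[OF X] flip: \<Phi>_expand)
  finally show ?thesis .
qed

lemma vprod_commutator:
  assumes X: "X \<in> vector_fields n A" and Y: "Y \<in> vector_fields n A"
  shows "vf_diff (vprod X Y) (vprod Y X) = vf_bracket X Y"
proof (intro ext)
  fix p f
  show "vf_diff (vprod X Y) (vprod Y X) p f = vf_bracket X Y p f"
  proof (cases "f \<in> smooth_functions n A")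
    case True
    have "\<Phi> (rmult (\<alpha> X p) (\<alpha> Y p) - rmult (\<alpha> Y p) (\<alpha> X p)) p f
        = \<Phi> (\<alpha> X p) p (\<lambda>q. \<Phi> (\<alpha> Y p) q f) - \<Phi> (\<alpha> Y p) p (\<lambda>q. \<Phi> (\<alpha> X p) q f)"
      by (simp add: bracket vf_bracket_def)
    then show ?thesis
      by (simp add: vf_diff_def vf_bracket_def vprod_apply vprod_vec_def \<Phi>_add_apply \<Phi>_diff_apply
          vector_field_iterate[OF X Y True] vector_field_iterate[OF Y X True])
  next
    case False
    \<comment> \<open>For non-smooth \<open>f\<close> the inner functions of the bracket are the
      zero function. It is smooth, so the default value does not apply and linearity must give
      0.\<close>
    have zero: "Z p (\<lambda>q. 0) = 0" if "Z \<in> vector_fields n A" for Z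
      using tangent_cmult[OF vector_field_tangent[OF that] smooth_functions_const[OF M], of p 0 0] by simp
    show ?thesis
      using vector_field_non_smooth[OF X False] vector_field_non_smooth[OF Y False] zero[OF X] zero[OF Y]
        vector_field_non_smooth[OF vprod_in[OF X Y] False] vector_field_non_smooth[OF vprod_in[OF Y X] False]
      by (simp add: vf_diff_def vf_bracket_def)
  qed
qed

text \<open>In the coefficient of the associator the terms
  \<open>rmult (vec_deriv (X p) (\<alpha> Y)) (\<alpha> Z p)\<close> cancel. What remains consists
  of a mixed part visibly symmetric in \<open>X\<close> and \<open>Y\<close>, a second-order part
  symmetric by \<open>vprod_commutator\<close>, and the associator of the algebra, symmetric by
  \<open>qa\<close>.\<close>

lemma vprod_quasiassociative: "quasiassociative_on (vector_fields n A) vf_diff vprod"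
  unfolding quasiassociative_on_def
proof (intro ballI ext)
  fix X Y Z p f
  assume X: "X \<in> vector_fields n A" and Y: "Y \<in> vector_fields n A" and Z: "Z \<in> vector_fields n A"
  have left: "vprod_vec X (vprod Y Z) p = vec_deriv (X p) (\<lambda>q. vec_deriv (Y q) (\<alpha> Z))
      + rmult (vec_deriv (X p) (\<alpha> Y)) (\<alpha> Z p) + rmult (\<alpha> Y p) (vec_deriv (X p) (\<alpha> Z))
      + rmult (\<alpha> X p) (vec_deriv (Y p) (\<alpha> Z)) + rmult (\<alpha> X p) (rmult (\<alpha> Y p) (\<alpha> Z p))"
    if X: "X \<in> vector_fields n A" and Y: "Y \<in> vector_fields n A" for X Y
  proof -
    note v = vector_field_tangent[OF X, of p]
    have "\<alpha> (vprod Y Z) = (\<lambda>q. vec_deriv (Y q) (\<alpha> Z) + rmult (\<alpha> Y q) (\<alpha> Z q))"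
      by (simp add: fun_eq_iff \<alpha>_vprod Y Z)
    then show ?thesis
      by (simp add: vprod_vec_def bilinear_radd[OF bil]
          vec_deriv_add[OF v smooth_vec_deriv[OF Y \<alpha>_smooth_vec[OF Z]]
            smooth_vec_rmult[OF \<alpha>_smooth_vec[OF Y] \<alpha>_smooth_vec[OF Z]]]
          vec_deriv_rmult[OF v \<alpha>_smooth_vec[OF Y] \<alpha>_smooth_vec[OF Z]])
  qed
  have right: "vprod_vec (vprod X Y) Z p = vec_deriv (vprod X Y p) (\<alpha> Z)
      + rmult (vec_deriv (X p) (\<alpha> Y)) (\<alpha> Z p) + rmult (rmult (\<alpha> X p) (\<alpha> Y p)) (\<alpha> Z p)"
    if X: "X \<in> vector_fields n A" and Y: "Y \<in> vector_fields n A" for X Y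
    by (simp add: vprod_vec_def \<alpha>_vprod X Y bilinear_ladd[OF bil])
  \<comment> \<open>Acting coordinatewise on \<open>\<alpha> Z\<close>, the commutator of the
    product is the commutator of derivations.\<close>
  have comm: "vec_deriv (vprod X Y p) (\<alpha> Z) - vec_deriv (vprod Y X p) (\<alpha> Z)
      = vec_deriv (X p) (\<lambda>q. vec_deriv (Y q) (\<alpha> Z)) - vec_deriv (Y p) (\<lambda>q. vec_deriv (X q) (\<alpha> Z))"
  proof -
    have it: "vec_deriv (X p) (\<lambda>q. vec_deriv (Y q) (\<alpha> Z)) = (\<Sum>b\<in>B. X p (\<lambda>q. Y q (\<lambda>r. coord b (\<alpha> Z r))) *\<^sub>R b)"
      if X: "X \<in> vector_fields n A" and Y: "Y \<in> vector_fields n A" for X Y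
      unfolding vec_deriv_def[of "Y q" for q]
      by (rule vec_deriv_sum[OF vector_field_tangent[OF X]])
        (rule vector_field_smooth[OF Y smooth_vecD[OF \<alpha>_smooth_vec[OF Z]]])
    have "vprod X Y p g - vprod Y X p g = X p (\<lambda>q. Y q g) - Y p (\<lambda>q. X q g)" for g
      using fun_cong[OF fun_cong[OF vprod_commutator[OF X Y], of p], of g]
      by (simp add: vf_diff_def vf_bracket_def)
    then show ?thesis
      unfolding it[OF X Y] it[OF Y X] vec_deriv_def[of "vprod X Y p"] vec_deriv_def[of "vprod Y X p"]
      by (simp flip: sum_subtractf scaleR_diff_left)
  qed
  have regroup: "vprod_vec X (vprod Y Z) p - vprod_vec (vprod X Y) Z p =
      (vec_deriv (X p) (\<lambda>q. vec_deriv (Y q) (\<alpha> Z)) - vec_deriv (vprod X Y p) (\<alpha> Z))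
      + (rmult (\<alpha> Y p) (vec_deriv (X p) (\<alpha> Z)) + rmult (\<alpha> X p) (vec_deriv (Y p) (\<alpha> Z)))
      + (rmult (\<alpha> X p) (rmult (\<alpha> Y p) (\<alpha> Z p)) - rmult (rmult (\<alpha> X p) (\<alpha> Y p)) (\<alpha> Z p))"
    if "X \<in> vector_fields n A" "Y \<in> vector_fields n A" for X Y
    unfolding left[OF that] right[OF that] by simp
  have "vec_deriv (X p) (\<lambda>q. vec_deriv (Y q) (\<alpha> Z)) - vec_deriv (vprod X Y p) (\<alpha> Z)
      = vec_deriv (Y p) (\<lambda>q. vec_deriv (X q) (\<alpha> Z)) - vec_deriv (vprod Y X p) (\<alpha> Z)"
    using comm by (simp add: algebra_simps)
  then have "vprod_vec X (vprod Y Z) p - vprod_vec (vprod X Y) Z p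
      = vprod_vec Y (vprod X Z) p - vprod_vec (vprod Y X) Z p"
    unfolding regroup[OF X Y] regroup[OF Y X] qa[of "\<alpha> X p" "\<alpha> Y p" "\<alpha> Z p"] by simp
  then show "vf_diff (vprod X (vprod Y Z)) (vprod (vprod X Y) Z) p f
      = vf_diff (vprod Y (vprod X Z)) (vprod (vprod Y X) Z) p f"
    by (simp add: vf_diff_def vprod_apply flip: \<Phi>_diff_apply)
qed

end

theorem propositionA3p3:
  fixes rmult :: "'r::real_vector \<Rightarrow> 'r \<Rightarrow> 'r"
    and n :: nat
    and A :: "('g::{t2_space, second_countable_topology}) chart set"
    and gmult :: "'g \<Rightarrow> 'g \<Rightarrow> 'g" and e :: 'g and ginv :: "'g \<Rightarrow> 'g"
  assumes "\<exists>B::'r set. finite B \<and> span B = UNIV"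
    and "bilinear rmult"
    and "quasiassociative_on UNIV (-) rmult"
    and "lie_group n A gmult e ginv"
    and "connected (UNIV :: 'g set)"
    and "has_lie_algebra n A gmult (commutator_bracket rmult)"
  shows "\<exists>vmult :: 'g vfield \<Rightarrow> 'g vfield \<Rightarrow> 'g vfield.
    (\<forall>X\<in>vector_fields n A. \<forall>Y\<in>vector_fields n A. vmult X Y \<in> vector_fields n A) \<and>
    vf_bilinear_on (vector_fields n A) vmult \<and>
    quasiassociative_on (vector_fields n A) vf_diff vmult \<and>
    (\<forall>X\<in>vector_fields n A. \<forall>Y\<in>vector_fields n A.
       vf_diff (vmult X Y) (vmult Y X) = vf_bracket X Y)"
proof -
  let ?L = "left_invariant_vector_fields n A gmult"
  note G = assms(4)
  obtain C :: "'r set" where C: "finite C" "span C = UNIV"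
    using assms(1) by (elim exE conjE)
  obtain B where B': "B \<subseteq> C" "independent B" "C \<subseteq> span B"
    using maximal_independent_subset[of C] by metis
  have finB: "finite B"
    using C(1) B'(1) by (rule finite_subset[rotated])
  have spanB: "span B = UNIV"
    using span_mono[OF B'(3)] C(2) by (simp add: span_span top.extremum_uniqueI)
  obtain \<Phi> where \<Phi>: "bij_betw \<Phi> UNIV ?L"
    and \<Phi>_add: "\<And>a b. \<Phi> (a + b) = vf_add (\<Phi> a) (\<Phi> b)"
    and \<Phi>_scale: "\<And>c a. \<Phi> (c *\<^sub>R a) = vf_scale c (\<Phi> a)"
    and \<Phi>_bracket: "\<And>a b. \<Phi> (commutator_bracket rmult a b) = vf_bracket (\<Phi> a) (\<Phi> b)"
    using assms(6) unfolding has_lie_algebra_def by auto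
  have \<Phi>_L: "\<Phi> a \<in> ?L" for a
    using \<Phi> by (auto simp: bij_betw_def)
  then have \<Phi>_vf: "\<Phi> a \<in> vector_fields n A" for a
    by (simp add: left_invariant_vector_fields_def)
  have \<Phi>_inj: "a = b" if "\<Phi> a p = \<Phi> b p" for a b p
    using left_invariant_eqI[OF G \<Phi>_L \<Phi>_L that] \<Phi> by (auto simp: bij_betw_def dest: injD)
  obtain E \<kappa> where E: "\<forall>i<n. E i \<in> ?L"
    and \<kappa>: "\<forall>X\<in>vector_fields n A. (\<forall>i. \<kappa> X i \<in> smooth_functions n A) \<and>
      (\<forall>p. \<forall>f\<in>smooth_functions n A. X p f = (\<Sum>i<n. \<kappa> X i p * E i p f))"
    using left_invariant_frame[OF G] by (elim exE conjE)
  \<comment> \<open>The frame is pulled back to the algebra along \<open>\<Phi>\<close>, and the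
    frame coefficients of \<open>X\<close> at \<open>p\<close> are gathered into one algebra
    element. Spanning gives existence and pointwise injectivity of \<open>\<Phi>\<close> gives
    uniqueness, with no matching between \<open>B\<close> and the indices below
    \<open>n\<close>.\<close>
  define \<alpha> where "\<alpha> = (\<lambda>X p. \<Sum>i<n. \<kappa> X i p *\<^sub>R inv \<Phi> (E i))"
  have \<Phi>_E: "\<Phi> (inv \<Phi> (E i)) = E i" if "i < n" for i
    using \<Phi> E that by (intro f_inv_into_f) (auto simp: bij_betw_def)
  have \<Phi>_0: "\<Phi> 0 p f = 0" for p f
    using \<Phi>_scale[of 0 0] by (simp add: vf_scale_def fun_eq_iff)
  have \<Phi>_sum: "\<Phi> (\<Sum>i\<in>I. c i *\<^sub>R a i) p f = (\<Sum>i\<in>I. c i * \<Phi> (a i) p f)" for I c p f and a :: "nat \<Rightarrow> 'r"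
    by (induction I rule: infinite_finite_induct) (simp_all add: \<Phi>_0 \<Phi>_add \<Phi>_scale vf_add_def vf_scale_def)
  have M: "smooth_manifold n A"
    by (rule lie_group_manifold[OF G])
  interpret left_symmetric_trivialization n A \<Phi> \<alpha> B rmult
  proof
    fix X p assume X: "X \<in> vector_fields n A"
    show "\<Phi> (\<alpha> X p) p = X p"
    proof
      fix f
      show "\<Phi> (\<alpha> X p) p f = X p f"
      proof (cases "f \<in> smooth_functions n A")
        case True
        then show ?thesis
          using \<kappa> X by (simp add: \<alpha>_def \<Phi>_sum \<Phi>_E)
      next
        \<comment> \<open>Both sides are tangent vectors at \<open>p\<close> and thus vanish on
          functions that are not smooth.\<close>
        case False
        then show ?thesis
          using X \<Phi>_vf[of "\<alpha> X p"] by (simp add: vector_fields_def tangent_space_def)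
      qed
    qed
  next
    fix X b assume X: "X \<in> vector_fields n A"
    have "(\<lambda>p. \<Sum>i<n. \<kappa> X i p * representation B (inv \<Phi> (E i)) b) \<in> smooth_functions n A"
      by (intro smooth_functions_sum[OF M] smooth_functions_mult[OF M] smooth_functions_const[OF M])
        (use \<kappa> X in blast)
    then show "(\<lambda>p. representation B (\<alpha> X p) b) \<in> smooth_functions n A"
      by (simp add: \<alpha>_def real_vector.representation_sum[OF B'(2)] real_vector.representation_scale[OF B'(2)] spanB)
  qed (use M finB B'(2) spanB \<Phi>_vf \<Phi>_add \<Phi>_scale \<Phi>_inj assms(2,3) \<Phi>_bracket
      in \<open>auto simp: quasiassociative_on_def commutator_bracket_def\<close>)
  show ?thesis
    using vprod_in vprod_bilinear vprod_quasiassociative vprod_commutator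
    by (intro exI[of _ vprod]) simp
qed

end
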